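(* Let $X$ and $Y$ be rooted trees in which each vertex has at least one child (and finitely many neighbors), let $\varepsilon_X,\varepsilon_Y>0$, and let $\partial X$, $\partial Y$ carry the visual metrics $d_X$, $d_Y$ determined by $\varepsilon_X$, $\varepsilon_Y$. Let $F:X\to Y$ be a rough quasiisometry satisfying, for some constants $L_1,L_2>0$ and $\Lambda\ge0$, $$L_1|x_1-x_2|-\Lambda\le|F(x_1)-F(x_2)|\le L_2|x_1-x_2|+\Lambda\quad\text{for all }x_1,x_2\in X,$$ and let $f:\partial X\to\partial Y$ be the boundary extension of $F$. Then $f$ is an $\eta$-quasisymmetric map, where $$\eta(t)=\begin{cases}At^{\alpha_1},& t\le1,\\ At^{\alpha_2},& t\ge1,\end{cases}\qquad \alpha_1=\frac{L_1\varepsilon_Y}{\varepsilon_X},\quad\alpha_2=\frac{L_2\varepsilon_Y}{\varepsilon_X},$$ for some $A>0$.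
   Context: A rooted tree $X$ is a connected graph without cycles, with a distinguished vertex $0_X$ (the root), all vertices having finite degree. The neighbor of a vertex closer to the root is its parent, all other neighbors are its children. For vertices, $|x-y|$ denotes the number of edges in the geodesic from $x$ to $y$. Rough quasiisometries are regarded as maps between the vertex sets, and $x\in X$ denotes a vertex. The weighted metric on $X$ is $d_X(x,y)=\int_{[x,y]}e^{-\varepsilon_X|z|}\,d|z|$, where $|z|$ is the distance from the root and $d|z|$ gives each edge Lebesgue measure $1$. The boundary $\partial X$ is the completion of $X$ minus $X$; its points are identified with the infinite geodesics starting at $0_X$. For distinct $\zeta,\xi\in\partial X$ whose geodesics from $0_X$ share exactly their first $k$ edges, the visual metric is $d_X(\zeta,\xi)=\frac{2}{\varepsilon_X}e^{-\varepsilon_Xk}$. Similarly for $Y$ with $\varepsilon_Y$. A (not necessarily continuous) map $F:X\to Y$ is an $(L,\Lambda)$-rough quasiisometry if $\frac1L|x-y|-\Lambda\le|F(x)-F(y)|\le L|x-y|+\Lambda$ for all $x,y\in X$, and for each $y\in Y$ there is $x\in X$ with $|F(x)-y|\le L+\Lambda$. In the claim, $F$ is an $(L,\Lambda)$-rough quasiisometry with $L=\max\{1/L_1,L_2\}$. Boundary extension: for $\zeta\in\partial X$ let $0_X=x_0,x_1,x_2,\dots$ be the consecutive vertices of the geodesic from $0_X$ to $\zeta$ and $Y_\zeta=\{F(x_i):i\in\mathbb{N}\}$. The closure of $Y_\zeta$ in the completion $\overline Y$ of $(Y,d_Y)$ meets $\partial Y$ in exactly one point, and $f(\zeta)$ is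 defined to be this point; equivalently $f(\zeta)=\lim_{i\to\infty}F(x_i)$ in $\overline Y$. A homeomorphism $f:Z\to W$ between metric spaces is $\eta$-quasisymmetric, where $\eta:[0,\infty)\to[0,\infty)$ is a homeomorphism, if $\frac{d_W(f(x),f(y))}{d_W(f(x),f(z))}\le\eta\bigl(\frac{d_Z(x,y)}{d_Z(x,z)}\bigr)$ for all $x,y,z\in Z$ with $x\ne z$. *)

theory Defs
  imports "HOL-Analysis.Analysis"
begin

section \<open>Rooted trees\<close>

text \<open>A graph is a vertex set together with a symmetric, irreflexive adjacency relation.\<close>

definition graph_cycle :: "'a rel \<Rightarrow> 'a list \<Rightarrow> bool" where
  "graph_cycle E xs \<longleftrightarrow> 3 \<le> length xs \<and> distinct xs \<and>
     successively (\<lambda>u v. (u, v) \<in> E) xs \<and> (last xs, hd xs) \<in> E"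

definition graph_dist :: "'a rel \<Rightarrow> 'a \<Rightarrow> 'a \<Rightarrow> nat" where
  "graph_dist E x y = (LEAST n. (x, y) \<in> E ^^ n)"

locale rooted_tree =
  fixes V :: "'a set" and E :: "'a rel" and r :: 'a
  assumes edges_subset: "E \<subseteq> V \<times> V"
    and edges_sym: "sym E"
    and edges_irrefl: "irrefl E"
    and root_in: "r \<in> V"
    and connected: "\<And>x y. x \<in> V \<Longrightarrow> y \<in> V \<Longrightarrow> (x, y) \<in> E\<^sup>*"
    and no_cycle: "\<not> graph_cycle E xs"
    and finite_degree: "\<And>x. x \<in> V \<Longrightarrow> finite (E `` {x})"

definition tree_children :: "'a rel \<Rightarrow> 'a \<Rightarrow> 'a \<Rightarrow> 'a set" where
  "tree_children E r x = {y. (x, y) \<in> E \<and> \<not> graph_dist E r y < graph_dist E r x}"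


section \<open>The weighted metric\<close>

text \<open>\<open>|z|\<close> runs linearly between \<open>|u|\<close> and \<open>|v|\<close> as \<open>z\<close> runs along the edge \<open>uv\<close>.\<close>

definition edge_length :: "'a rel \<Rightarrow> 'a \<Rightarrow> real \<Rightarrow> 'a \<Rightarrow> 'a \<Rightarrow> real" where
  "edge_length E r \<epsilon> u v =
     integral {real (min (graph_dist E r u) (graph_dist E r v)) ..
               real (max (graph_dist E r u) (graph_dist E r v))} (\<lambda>t. exp (- \<epsilon> * t))"

definition geodesic_segment :: "'a rel \<Rightarrow> 'a \<Rightarrow> 'a \<Rightarrow> (nat \<Rightarrow> 'a) \<Rightarrow> bool" where
  "geodesic_segment E x y \<gamma> \<longleftrightarrow> \<gamma> 0 = x \<and> \<gamma> (graph_dist E x y) = y \<and>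
     (\<forall>i < graph_dist E x y. (\<gamma> i, \<gamma> (Suc i)) \<in> E)"

text \<open>The choice of \<open>\<gamma>\<close> is immaterial, see \<open>tree_dist_geodesic\<close> below.\<close>

definition tree_dist :: "'a rel \<Rightarrow> 'a \<Rightarrow> real \<Rightarrow> 'a \<Rightarrow> 'a \<Rightarrow> real" where
  "tree_dist E r \<epsilon> x y = (let \<gamma> = SOME \<gamma>. geodesic_segment E x y \<gamma>
     in \<Sum>i < graph_dist E x y. edge_length E r \<epsilon> (\<gamma> i) (\<gamma> (Suc i)))"


section \<open>The boundary and the completion\<close>

definition tree_boundary :: "'a set \<Rightarrow> 'a rel \<Rightarrow> 'a \<Rightarrow> (nat \<Rightarrow> 'a) set" where
  "tree_boundary V E r =
     {\<zeta>. \<zeta> 0 = r \<and> range \<zeta> \<subseteq> V \<and> (\<forall>i j. i \<le> j \<longrightarrow> graph_dist E (\<zeta> i) (\<zeta> j) = j - i)}"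

text \<open>The \<open>LEAST\<close> is the number of initial edges shared by two distinct geodesics from the root.\<close>

definition visual_dist :: "real \<Rightarrow> (nat \<Rightarrow> 'a) \<Rightarrow> (nat \<Rightarrow> 'a) \<Rightarrow> real" where
  "visual_dist \<epsilon> \<zeta> \<xi> =
     (if \<zeta> = \<xi> then 0
      else 2 / \<epsilon> * exp (- \<epsilon> * real (LEAST k. \<zeta> (Suc k) \<noteq> \<xi> (Suc k))))"

text \<open>
  The completion of the tree consists of its vertices \<open>Inl x\<close> and its boundary points \<open>Inr \<zeta>\<close>;
  a boundary point is represented by the Cauchy sequence of vertices on its geodesic, and
  distances are limits of distances along representing sequences (and, to have a total
  metric, \<open>0\<close> off the completion). That this is indeed the
  completion of the set of vertices, and that it induces the visual metric on the boundary,
  is shown in \<open>Metric_space_completion\<close>, \<open>completion_dist_vertices\<close>,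
  \<open>vertices_dense\<close>, \<open>completion_complete\<close> and \<open>completion_dist_boundary\<close>. Leaving out the interior points of the edges does not affect the
  boundary, nor which sets of vertices accumulate at which boundary points.
\<close>

definition tree_completion :: "'a set \<Rightarrow> 'a rel \<Rightarrow> 'a \<Rightarrow> ('a + (nat \<Rightarrow> 'a)) set" where
  "tree_completion V E r = Inl ` V \<union> Inr ` tree_boundary V E r"

definition rep_seq :: "'a + (nat \<Rightarrow> 'a) \<Rightarrow> nat \<Rightarrow> 'a" where
  "rep_seq p n = (case p of Inl x \<Rightarrow> x | Inr \<zeta> \<Rightarrow> \<zeta> n)"

definition completion_dist ::
    "'a set \<Rightarrow> 'a rel \<Rightarrow> 'a \<Rightarrow> real \<Rightarrow> 'a + (nat \<Rightarrow> 'a) \<Rightarrow> 'a + (nat \<Rightarrow> 'a) \<Rightarrow> real" where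
  "completion_dist V E r \<epsilon> p q =
     (if p \<in> tree_completion V E r \<and> q \<in> tree_completion V E r
      then lim (\<lambda>n. tree_dist E r \<epsilon> (rep_seq p n) (rep_seq q n)) else 0)"


section \<open>Rough quasiisometries, boundary extensions, quasisymmetric maps\<close>

definition rough_quasiisometry ::
    "'a set \<Rightarrow> 'a rel \<Rightarrow> 'b set \<Rightarrow> 'b rel \<Rightarrow> real \<Rightarrow> real \<Rightarrow> ('a \<Rightarrow> 'b) \<Rightarrow> bool" where
  "rough_quasiisometry V E V' E' L \<Lambda> F \<longleftrightarrow>
     F \<in> V \<rightarrow> V' \<and>
     (\<forall>x\<in>V. \<forall>y\<in>V.
        1 / L * real (graph_dist E x y) - \<Lambda> \<le> real (graph_dist E' (F x) (F y)) \<and>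
        real (graph_dist E' (F x) (F y)) \<le> L * real (graph_dist E x y) + \<Lambda>) \<and>
     (\<forall>y\<in>V'. \<exists>x\<in>V. real (graph_dist E' (F x) y) \<le> L + \<Lambda>)"

text \<open>The boundary extension: \<open>V\<close>, \<open>E\<close>, \<open>r\<close>, \<open>\<epsilon>\<close> belong to the target tree.\<close>

definition boundary_extension ::
    "'b set \<Rightarrow> 'b rel \<Rightarrow> 'b \<Rightarrow> real \<Rightarrow> ('a \<Rightarrow> 'b) \<Rightarrow> (nat \<Rightarrow> 'a) \<Rightarrow> (nat \<Rightarrow> 'b)" where
  "boundary_extension V E r \<epsilon> F \<zeta> =
     (THE \<xi>. \<xi> \<in> tree_boundary V E r \<and>
        Inr \<xi> \<in> Metric_space.mtopology (tree_completion V E r) (completion_dist V E r \<epsilon>)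
                 closure_of (Inl ` F ` range \<zeta>))"

definition quasisymmetric_map ::
    "(real \<Rightarrow> real) \<Rightarrow> 'a set \<Rightarrow> ('a \<Rightarrow> 'a \<Rightarrow> real) \<Rightarrow> 'b set \<Rightarrow> ('b \<Rightarrow> 'b \<Rightarrow> real)
       \<Rightarrow> ('a \<Rightarrow> 'b) \<Rightarrow> bool" where
  "quasisymmetric_map \<eta> Z d W d' f \<longleftrightarrow>
     homeomorphic_map (top_of_set {0..}) (top_of_set {0..}) \<eta> \<and>
     homeomorphic_map (Metric_space.mtopology Z d) (Metric_space.mtopology W d') f \<and>
     (\<forall>x\<in>Z. \<forall>y\<in>Z. \<forall>z\<in>Z. x \<noteq> z \<longrightarrow> d' (f x) (f y) / d' (f x) (f z) \<le> \<eta> (d x y / d x z))"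


section \<open>Basic properties\<close>

context rooted_tree
begin

abbreviation "gd \<equiv> graph_dist E"
abbreviation "lev \<equiv> graph_dist E r"

lemma edgeD: assumes "(x, y) \<in> E" shows "x \<in> V" "y \<in> V" "(y, x) \<in> E" "x \<noteq> y"
  using assms edges_subset edges_sym edges_irrefl by (auto dest: symD simp: irrefl_def)

lemma relpow_sym: "(x, y) \<in> E ^^ n \<Longrightarrow> (y, x) \<in> E ^^ n"
proof (induction n arbitrary: y)
  case (Suc n)
  then obtain z where "(x, z) \<in> E ^^ n" "(z, y) \<in> E" by auto
  then show ?case using Suc.IH edgeD(3) relpow_Suc_I2 by metis
qed auto

lemma gd_relpow: "x \<in> V \<Longrightarrow> y \<in> V \<Longrightarrow> (x, y) \<in> E ^^ gd x y"
  unfolding graph_dist_def using connected rtrancl_imp_relpow by (metis LeastI)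

lemma gd_le: "(x, y) \<in> E ^^ n \<Longrightarrow> gd x y \<le> n"
  unfolding graph_dist_def by (rule Least_le)

lemma gd_same [simp]: "gd x x = 0"
  using gd_le[of x x 0] by simp

lemma gd_commute: "x \<in> V \<Longrightarrow> y \<in> V \<Longrightarrow> gd x y = gd y x"
  by (meson antisym gd_le gd_relpow relpow_sym)

lemma gd_triangle: "x \<in> V \<Longrightarrow> y \<in> V \<Longrightarrow> z \<in> V \<Longrightarrow> gd x z \<le> gd x y + gd y z"
  by (meson gd_le gd_relpow relpow_trans)

lemma gd_eq_0: "x \<in> V \<Longrightarrow> y \<in> V \<Longrightarrow> gd x y = 0 \<longleftrightarrow> x = y"
  using gd_relpow[of x y] by auto

lemma gd_edge: "(x, y) \<in> E \<Longrightarrow> gd x y = 1"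
  using gd_le[of x y 1] gd_eq_0[of x y] edgeD[of x y] by fastforce

lemma lev_edge_le: "(x, y) \<in> E \<Longrightarrow> lev y \<le> Suc (lev x)"
  using gd_triangle[of r x y] gd_edge[of x y] edgeD[of x y] root_in by simp

lemma parent_ex:
  assumes "x \<in> V" "x \<noteq> r"
  shows "\<exists>p. (p, x) \<in> E \<and> lev x = Suc (lev p)"
proof -
  obtain n where n: "lev x = Suc n"
    using gd_eq_0[of r x] assms root_in by (cases "lev x") auto
  then obtain p where p: "(r, p) \<in> E ^^ n" "(p, x) \<in> E"
    using gd_relpow[of r x] assms root_in by auto
  have "lev p \<le> n" using p gd_le by blast
  moreover have "lev x \<le> Suc (lev p)" using p lev_edge_le by blast
  ultimately show ?thesis using n p by auto
qed

lemma no_horizontal_path: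
  assumes "distinct xs" "successively (\<lambda>u v. (u, v) \<in> E) xs" "2 \<le> length xs"
    "set xs \<subseteq> V" "lev (hd xs) = n" "lev (last xs) = n" "\<And>x. x \<in> set xs \<Longrightarrow> n \<le> lev x"
  shows False
  using assms
proof (induction n arbitrary: xs)
  case 0
  have "xs \<noteq> []" using 0 by auto
  then have "hd xs = r" "last xs = r"
    using 0 gd_eq_0[of r] root_in by (metis hd_in_set subsetD, metis last_in_set subsetD)
  then have "hd xs = last xs" by simp
  then show False using 0 by (cases xs) (auto split: if_splits)
next
  case (Suc n)
  have ne: "xs \<noteq> []" using Suc by auto
  obtain p where p: "(p, hd xs) \<in> E" "lev p = n"
    using parent_ex[of "hd xs"] Suc.prems ne
    by (metis gd_same hd_in_set nat.inject nat.simps(3) subsetD)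
  obtain q where q: "(q, last xs) \<in> E" "lev q = n"
    using parent_ex[of "last xs"] Suc.prems ne
    by (metis gd_same last_in_set nat.inject nat.simps(3) subsetD)
  have pq: "p \<notin> set xs" "q \<notin> set xs" using p q Suc.prems(7) by fastforce+
  have s: "successively (\<lambda>u v. (u, v) \<in> E) (p # xs)"
    using p Suc.prems ne by (simp add: successively_Cons)
  show False
  proof (cases "p = q")
    case True
    then have "graph_cycle E (p # xs)"
      unfolding graph_cycle_def using s Suc.prems pq edgeD(3)[OF q(1)] ne by simp
    then show False using no_cycle by blast
  next
    case False
    have "successively (\<lambda>u v. (u, v) \<in> E) ((p # xs) @ [q])"
      unfolding successively_append_iff using s edgeD(3)[OF q(1)] ne by simp
    moreover have "set (p # xs @ [q]) \<subseteq> V"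
      using Suc.prems(4) edgeD(1)[OF p(1)] edgeD(1)[OF q(1)] by simp
    moreover have "n \<le> lev x" if "x \<in> set (p # xs @ [q])" for x
      using that Suc.prems(7)[of x] p(2) q(2) by auto
    ultimately show False
      using Suc.IH[of "(p # xs) @ [q]"] False pq Suc.prems(1) p(2) q(2) by simp
  qed
qed

lemma lev_edge:
  assumes "(x, y) \<in> E"
  shows "lev x = Suc (lev y) \<or> lev y = Suc (lev x)"
proof -
  have "lev x \<noteq> lev y"
    using no_horizontal_path[of "[x, y]" "lev x"] edgeD[OF assms] assms by fastforce
  then show ?thesis
    using lev_edge_le[OF assms] lev_edge_le[OF edgeD(3)[OF assms]] by linarith
qed

lemma parent_unique:
  assumes "(p, x) \<in> E" "(q, x) \<in> E" "lev x = Suc (lev p)" "lev x = Suc (lev q)"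
  shows "p = q"
  using no_horizontal_path[of "[p, x, q]" "lev p"] edgeD[OF assms(1)] edgeD[OF assms(2)] assms
  by fastforce

definition "par x = (SOME p. (p, x) \<in> E \<and> lev x = Suc (lev p))"

definition "anc x k = (par ^^ (lev x - k)) x"

lemma par:
  assumes "x \<in> V" "lev x \<noteq> 0"
  shows "(par x, x) \<in> E" "lev x = Suc (lev (par x))"
proof -
  have "x \<noteq> r" using assms by auto
  then have "(par x, x) \<in> E \<and> lev x = Suc (lev (par x))"
    unfolding par_def using parent_ex[OF assms(1)] by (rule_tac someI_ex) auto
  then show "(par x, x) \<in> E" "lev x = Suc (lev (par x))" by auto
qed

lemma par_eq: "(p, x) \<in> E \<Longrightarrow> lev x = Suc (lev p) \<Longrightarrow> par x = p"
  by (rule parent_unique[of _ x]) (use par[of x] edgeD(2)[of p x] in \<open>simp_all only: nat.simps not_False_eq_True simp_thms\<close>)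

lemma par_pow:
  assumes "x \<in> V" "m \<le> lev x"
  shows "(par ^^ m) x \<in> V \<and> lev ((par ^^ m) x) = lev x - m \<and> ((par ^^ m) x, x) \<in> E ^^ m"
  using assms(2)
proof (induction m)
  case 0 then show ?case using assms by auto
next
  case (Suc m)
  let ?z = "(par ^^ m) x"
  have z: "?z \<in> V" "lev ?z = lev x - m" "(?z, x) \<in> E ^^ m" using Suc by auto
  then have "lev ?z \<noteq> 0" using Suc by auto
  from par[OF z(1) this] show ?case
    using z relpow_Suc_I2[of "par ?z" ?z E x m] edgeD(1) by auto
qed

lemma anc:
  assumes "x \<in> V" "k \<le> lev x"
  shows "anc x k \<in> V" "lev (anc x k) = k" "(anc x k, x) \<in> E ^^ (lev x - k)"
  using par_pow[OF assms(1), of "lev x - k"] assms by (auto simp: anc_def)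

lemma anc_self [simp]: "anc x (lev x) = x"
  by (simp add: anc_def)

lemma anc_anc:
  assumes "x \<in> V" "j \<le> k" "k \<le> lev x"
  shows "anc (anc x k) j = anc x j"
proof -
  have "anc (anc x k) j = (par ^^ (k - j)) ((par ^^ (lev x - k)) x)"
    using anc[OF assms(1,3)] by (simp add: anc_def)
  also have "\<dots> = (par ^^ ((k - j) + (lev x - k))) x" by (simp add: funpow_add)
  also have "(k - j) + (lev x - k) = lev x - j" using assms by simp
  finally show ?thesis by (simp add: anc_def)
qed

lemma anc_child:
  assumes "(u, v) \<in> E" "lev v = Suc (lev u)" "k \<le> lev u"
  shows "anc v k = anc u k"
proof -
  have "lev v - k = Suc (lev u - k)" using assms by simp
  then have "anc v k = (par ^^ Suc (lev u - k)) v" by (simp only: anc_def)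
  also have "\<dots> = anc u k" by (simp only: funpow_Suc_right o_apply par_eq[OF assms(1,2)] anc_def)
  finally show ?thesis .
qed

definition "meet x y = (GREATEST k. k \<le> lev x \<and> k \<le> lev y \<and> anc x k = anc y k)"

lemma anc_0: "x \<in> V \<Longrightarrow> anc x 0 = r"
  using anc[of x 0] gd_eq_0[of r "anc x 0"] root_in by auto

lemma le_meet:
  assumes "x \<in> V" "y \<in> V"
  shows "k \<le> meet x y \<longleftrightarrow> k \<le> lev x \<and> k \<le> lev y \<and> anc x k = anc y k"
proof -
  let ?P = "\<lambda>k. k \<le> lev x \<and> k \<le> lev y \<and> anc x k = anc y k"
  have "?P 0" using assms by (simp add: anc_0)
  then have g: "?P (meet x y)"
    unfolding meet_def by (rule GreatestI_nat[where b = "lev x"]) auto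
  have "?P k \<Longrightarrow> k \<le> meet x y"
    unfolding meet_def by (rule Greatest_le_nat[where b = "lev x"]) auto
  moreover have "k \<le> meet x y \<Longrightarrow> ?P k"
    using g anc_anc[OF assms(1), of k "meet x y"] anc_anc[OF assms(2), of k "meet x y"] by auto
  ultimately show ?thesis by blast
qed

lemma meetI: "(\<And>k. k \<le> meet x y \<longleftrightarrow> k \<le> m) \<Longrightarrow> meet x y = m"
  by (meson le_antisym le_refl)

lemma meet_le: "x \<in> V \<Longrightarrow> y \<in> V \<Longrightarrow> meet x y \<le> lev x" "x \<in> V \<Longrightarrow> y \<in> V \<Longrightarrow> meet x y \<le> lev y"
  using le_meet[of x y "meet x y"] by auto

lemma meet_commute: "meet x y = meet y x"
  unfolding meet_def by (rule arg_cong[where f = Greatest]) auto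

lemma meet_self: "x \<in> V \<Longrightarrow> meet x x = lev x"
  by (rule meetI) (auto simp: le_meet)

lemma meet_eq: "x \<in> V \<Longrightarrow> y \<in> V \<Longrightarrow> meet x y = lev x \<Longrightarrow> meet x y = lev y \<Longrightarrow> x = y"
  using le_meet[of x y "meet x y"] anc_self[of x] anc_self[of y] by simp

lemma meet_child:
  assumes "x \<in> V" "(u, v) \<in> E" "lev v = Suc (lev u)"
  shows "meet x v = meet x u \<or> (meet x v = lev v \<and> meet x u = lev u)"
proof -
  have uv: "u \<in> V" "v \<in> V" using edgeD assms by auto
  have eq: "k \<le> lev u \<Longrightarrow> k \<le> meet x v \<longleftrightarrow> k \<le> meet x u" for k
    using le_meet[of x u k] le_meet[of x v k] assms uv anc_child[OF assms(2,3), of k] by auto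
  have b: "meet x u \<le> lev u" "meet x v \<le> lev v" using meet_le[OF assms(1) uv(1)] meet_le[OF assms(1) uv(2)] by auto
  show ?thesis
  proof (cases "meet x v = lev v")
    case True
    then show ?thesis using eq[of "lev u"] b assms by auto
  next
    case False
    then have "meet x v \<le> lev u" using b assms by auto
    then show ?thesis using eq[of "meet x v"] eq[of "meet x u"] b by simp
  qed
qed

definition hdist :: "(nat \<Rightarrow> real) \<Rightarrow> 'a \<Rightarrow> 'a \<Rightarrow> real" where
  "hdist h x y = h (lev x) + h (lev y) - 2 * h (meet x y)"

definition hedge :: "(nat \<Rightarrow> real) \<Rightarrow> 'a \<Rightarrow> 'a \<Rightarrow> real" where
  "hedge h u v = \<bar>h (lev u) - h (lev v)\<bar>"

lemma hdist_step:
  assumes "x \<in> V" "(u, v) \<in> E"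
  shows "(\<forall>h. mono h \<longrightarrow> hdist h x v = hdist h x u + hedge h u v) \<or>
         (\<forall>h. mono h \<longrightarrow> hdist h x v = hdist h x u - hedge h u v)"
proof -
  have w: "hedge h u v = h (Suc k) - h k"
    if "mono h" "lev u = Suc k \<and> lev v = k \<or> lev v = Suc k \<and> lev u = k" for h k
    using that monoD[OF that(1), of k "Suc k"] by (auto simp: hedge_def)
  from lev_edge[OF assms(2)] show ?thesis
  proof
    assume l: "lev u = Suc (lev v)"
    show ?thesis
      using meet_child[OF assms(1) edgeD(3)[OF assms(2)] l]
      by (rule disjE) (simp_all add: hdist_def l w[of _ "lev v"])
  next
    assume l: "lev v = Suc (lev u)"
    show ?thesis
      using meet_child[OF assms(1,2) l]
      by (rule disjE) (simp_all add: hdist_def l w[of _ "lev u"])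
  qed
qed

lemma hdist_self: "x \<in> V \<Longrightarrow> hdist h x x = 0"
  by (simp add: hdist_def meet_self)

lemma hdist_commute: "hdist h x y = hdist h y x"
  by (simp add: hdist_def meet_commute)

lemma hdist_walk:
  assumes "x \<in> V" "mono h" "\<And>i. i < n \<Longrightarrow> (\<gamma> i, \<gamma> (Suc i)) \<in> E"
  shows "hdist h x (\<gamma> n) \<le> hdist h x (\<gamma> 0) + (\<Sum>i<n. hedge h (\<gamma> i) (\<gamma> (Suc i)))"
  using assms(3)
proof (induction n)
  case (Suc n)
  have "hedge h (\<gamma> n) (\<gamma> (Suc n)) \<ge> 0" by (simp add: hedge_def)
  with hdist_step[OF assms(1) Suc.prems[of n]]
  have "hdist h x (\<gamma> (Suc n)) \<le> hdist h x (\<gamma> n) + hedge h (\<gamma> n) (\<gamma> (Suc n))"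
    using assms(2) by auto
  with Suc show ?case by simp
qed simp

lemma hedge_real: "(u, v) \<in> E \<Longrightarrow> hedge real u v = 1"
  using lev_edge[of u v] by (auto simp: hedge_def)

lemma mono_real: "mono real"
  by (simp add: mono_def)

lemma gd_eq_hdist:
  assumes "x \<in> V" "y \<in> V"
  shows "real (gd x y) = hdist real x y"
proof (rule antisym)
  define c where "c = meet x y"
  have c: "c \<le> lev x" "c \<le> lev y" "anc x c = anc y c" using le_meet[OF assms, of c] c_def by auto
  have "gd x y \<le> gd x (anc x c) + gd (anc y c) y"
    using gd_triangle[of x "anc x c" y] assms anc c by auto
  also have "\<dots> = gd (anc x c) x + gd (anc y c) y" using gd_commute assms anc c by simp
  also have "\<dots> \<le> (lev x - c) + (lev y - c)" by (intro add_mono gd_le anc assms c)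
  finally show "real (gd x y) \<le> hdist real x y" using c by (auto simp: hdist_def c_def)
next
  obtain \<gamma> where g: "\<gamma> 0 = x" "\<gamma> (gd x y) = y" "\<And>i. i < gd x y \<Longrightarrow> (\<gamma> i, \<gamma> (Suc i)) \<in> E"
    using gd_relpow[OF assms] unfolding relpow_fun_conv by auto
  have "(\<Sum>i<gd x y. hedge real (\<gamma> i) (\<gamma> (Suc i))) = (\<Sum>i<gd x y. 1)"
    by (rule sum.cong) (use g hedge_real in auto)
  then show "hdist real x y \<le> real (gd x y)"
    using hdist_walk[of x real "gd x y" \<gamma>] g assms mono_real hdist_self[of x real] by simp
qed

lemma geodesic_ex: "x \<in> V \<Longrightarrow> y \<in> V \<Longrightarrow> \<exists>\<gamma>. geodesic_segment E x y \<gamma>"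
  using gd_relpow[of x y] unfolding relpow_fun_conv geodesic_segment_def by auto

lemma hdist_geodesic:
  assumes "x \<in> V" "y \<in> V" "geodesic_segment E x y \<gamma>" "mono h"
  shows "(\<Sum>i < gd x y. hedge h (\<gamma> i) (\<gamma> (Suc i))) = hdist h x y"
proof -
  let ?n = "gd x y"
  have g: "\<gamma> 0 = x" "\<gamma> ?n = y" "\<And>i. i < ?n \<Longrightarrow> (\<gamma> i, \<gamma> (Suc i)) \<in> E"
    using assms(3) by (auto simp: geodesic_segment_def)
  have V: "i \<le> ?n \<Longrightarrow> \<gamma> i \<in> V" for i
    using g assms edgeD by (cases "i < ?n") auto
  have a: "(\<gamma> i, \<gamma> (i + j)) \<in> E ^^ j" if "i + j \<le> ?n" for i j
    unfolding relpow_fun_conv using that g by (intro exI[of _ "\<lambda>k. \<gamma> (i + k)"]) auto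
  have d: "gd x (\<gamma> i) = i" if "i \<le> ?n" for i
  proof -
    have 1: "gd x (\<gamma> i) \<le> i" using gd_le[OF a[of 0 i]] that g by simp
    have 2: "gd (\<gamma> i) y \<le> ?n - i" using gd_le[OF a[of i "?n - i"]] that g by simp
    have "?n \<le> gd x (\<gamma> i) + gd (\<gamma> i) y" using gd_triangle[of x "\<gamma> i" y] assms V that by simp
    then show ?thesis using 1 2 that by linarith
  qed
  have "(\<Sum>i<m. hedge h (\<gamma> i) (\<gamma> (Suc i))) = hdist h x (\<gamma> m)" if "m \<le> ?n" for m
    using that
  proof (induction m)
    case 0
    then show ?case using g hdist_self assms by simp
  next
    case (Suc m)
    then have e: "(\<gamma> m, \<gamma> (Suc m)) \<in> E" using g by simp
    have dd: "hdist real x (\<gamma> (Suc m)) = Suc m" "hdist real x (\<gamma> m) = m"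
      using d[of m] d[of "Suc m"] gd_eq_hdist[OF assms(1) V, of m]
        gd_eq_hdist[OF assms(1) V, of "Suc m"] Suc.prems by auto
    have "hdist h x (\<gamma> (Suc m)) = hdist h x (\<gamma> m) + hedge h (\<gamma> m) (\<gamma> (Suc m))"
      by (rule disjE[OF hdist_step[OF assms(1) e]])
         (use assms(4) in blast, use dd hedge_real[OF e] mono_real in \<open>force\<close>)
    then show ?case using Suc by simp
  qed
  from this[of ?n] show ?thesis using g by simp
qed

lemma hdist_triangle:
  assumes "x \<in> V" "y \<in> V" "z \<in> V" "mono h"
  shows "hdist h x z \<le> hdist h x y + hdist h y z"
proof -
  obtain \<gamma> where g: "geodesic_segment E y z \<gamma>" using geodesic_ex assms by blast
  then show ?thesis
    using hdist_walk[OF assms(1,4), of "gd y z" \<gamma>] hdist_geodesic[OF assms(2,3) g assms(4)]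
    by (auto simp: geodesic_segment_def)
qed

end

locale weighted_tree = rooted_tree +
  fixes \<epsilon> :: real
  assumes eps_pos: "\<epsilon> > 0"
begin

definition wt :: "nat \<Rightarrow> real" where "wt n = (1 - exp (- \<epsilon> * real n)) / \<epsilon>"

definition wstep :: "nat \<Rightarrow> real" where "wstep n = wt (Suc n) - wt n"

lemma wt_less: "m < n \<Longrightarrow> wt m < wt n"
  using eps_pos by (simp add: wt_def divide_strict_right_mono)

lemma wt_le: "m \<le> n \<Longrightarrow> wt m \<le> wt n"
  using wt_less[of m n] by (cases "m = n") auto

lemma wt_mono: "mono wt"
  by (simp add: mono_def wt_le)

lemma wt_inj: "wt m = wt n \<longleftrightarrow> m = n"
  using wt_less[of m n] wt_less[of n m] by (cases m n rule: linorder_cases) auto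

lemma wt_lim: "wt \<longlonglongrightarrow> 1 / \<epsilon>"
proof -
  have "(\<lambda>n. exp (- \<epsilon>) ^ n) \<longlonglongrightarrow> 0"
    using eps_pos by (intro LIMSEQ_power_zero) auto
  then have "(\<lambda>n. (1 - exp (- \<epsilon>) ^ n) / \<epsilon>) \<longlonglongrightarrow> (1 - 0) / \<epsilon>"
    using eps_pos by (intro tendsto_intros) auto
  moreover have "wt = (\<lambda>n. (1 - exp (- \<epsilon>) ^ n) / \<epsilon>)"
    by (rule ext) (simp add: wt_def exp_of_nat_mult[symmetric] mult.commute)
  ultimately show ?thesis by simp
qed

lemma wt_bound: "wt n < 1 / \<epsilon>"
  using eps_pos by (simp add: wt_def divide_strict_right_mono)

lemma wstep_eq: "wstep n = exp (- \<epsilon> * real n) * ((1 - exp (- \<epsilon>)) / \<epsilon>)"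
  by (simp add: wstep_def wt_def diff_divide_distrib[symmetric] ring_distribs exp_add[symmetric])

lemma wstep_pos: "wstep n > 0"
  by (simp add: wstep_def wt_less)

lemma wstep_antimono: "m \<le> n \<Longrightarrow> wstep n \<le> wstep m"
  unfolding wstep_eq using eps_pos by (intro mult_right_mono) auto

lemma wt_diff: "m < n \<Longrightarrow> m \<le> k \<Longrightarrow> wstep k \<le> wt n - wt m"
  using wt_le[of "Suc m" n] wstep_antimono[of m k] by (simp add: wstep_def)

lemma edge_length_eq: "edge_length E r \<epsilon> u v = hedge wt u v"
proof -
  have *: "integral {real a..real b} (\<lambda>t. exp (- \<epsilon> * t)) = wt b - wt a" if "a \<le> b" for a b
  proof -
    have "((\<lambda>t. exp (- \<epsilon> * t)) has_integral
        (- exp (- \<epsilon> * real b) / \<epsilon>) - (- exp (- \<epsilon> * real a) / \<epsilon>)) {real a..real b}"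
      using that eps_pos
      by (intro fundamental_theorem_of_calculus)
         (auto intro!: derivative_eq_intros simp flip: has_real_derivative_iff_has_vector_derivative)
    from integral_unique[OF this] show ?thesis by (simp add: wt_def diff_divide_distrib)
  qed
  have "edge_length E r \<epsilon> u v = wt (max (lev u) (lev v)) - wt (min (lev u) (lev v))"
    unfolding edge_length_def by (rule *) simp
  then show ?thesis
    using wt_le[of "lev u" "lev v"] wt_le[of "lev v" "lev u"]
    by (auto simp: hedge_def max_def min_def)
qed

abbreviation "d \<equiv> tree_dist E r \<epsilon>"

lemma tree_dist_eq: assumes "x \<in> V" "y \<in> V" shows "d x y = hdist wt x y"
proof -
  have "geodesic_segment E x y (SOME \<gamma>. geodesic_segment E x y \<gamma>)"
    by (rule someI_ex[OF geodesic_ex[OF assms]])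
  from hdist_geodesic[OF assms this wt_mono] show ?thesis
    unfolding tree_dist_def Let_def edge_length_eq .
qed

lemma tree_dist_geodesic:
  assumes "x \<in> V" "y \<in> V" "geodesic_segment E x y \<gamma>"
  shows "d x y = (\<Sum>i < gd x y. edge_length E r \<epsilon> (\<gamma> i) (\<gamma> (Suc i)))"
  unfolding edge_length_eq tree_dist_eq[OF assms(1,2)] hdist_geodesic[OF assms wt_mono] ..

lemma d_eq: "x \<in> V \<Longrightarrow> y \<in> V \<Longrightarrow>
    d x y = (wt (lev x) - wt (meet x y)) + (wt (lev y) - wt (meet x y))"
  by (simp add: tree_dist_eq hdist_def)

lemma d_commute: "x \<in> V \<Longrightarrow> y \<in> V \<Longrightarrow> d x y = d y x"
  by (simp add: tree_dist_eq hdist_commute)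

lemma d_triangle: "x \<in> V \<Longrightarrow> y \<in> V \<Longrightarrow> z \<in> V \<Longrightarrow> d x z \<le> d x y + d y z"
  by (simp add: tree_dist_eq hdist_triangle wt_mono)

lemma d_self: "x \<in> V \<Longrightarrow> d x x = 0"
  by (simp add: tree_dist_eq hdist_self)

lemma meet_wt: assumes "x \<in> V" "y \<in> V"
  shows "wt (meet x y) \<le> wt (lev x)" "wt (meet x y) \<le> wt (lev y)"
  using meet_le[OF assms] by (auto intro: wt_le)

lemma d_nonneg: "x \<in> V \<Longrightarrow> y \<in> V \<Longrightarrow> 0 \<le> d x y"
  using meet_wt[of x y] by (simp add: d_eq)

lemma d_ge: "x \<in> V \<Longrightarrow> y \<in> V \<Longrightarrow> wt (lev x) - wt (meet x y) \<le> d x y"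
  using meet_wt[of x y] by (simp add: d_eq)

lemma d_ge_lev: "x \<in> V \<Longrightarrow> y \<in> V \<Longrightarrow> wt (lev y) - wt (lev x) \<le> d x y"
  using meet_wt[of x y] by (simp add: d_eq)

lemma d_isolated: assumes "x \<in> V" "y \<in> V" "x \<noteq> y" shows "wstep (lev x) \<le> d x y"
proof (cases "meet x y = lev x")
  case True
  then have "lev x < lev y" using meet_eq[OF assms(1,2)] meet_le[OF assms(1,2)] assms(3)
    by (metis le_neq_implies_less)
  then show ?thesis using True wt_diff[of "lev x" "lev y" "lev x"] assms by (simp add: d_eq)
next
  case False
  then have "meet x y < lev x" using meet_le[OF assms(1,2)] by simp
  then show ?thesis using wt_diff[of "meet x y" "lev x" "lev x"] d_ge[OF assms(1,2)] by simp
qed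

lemma d_eq_0: "x \<in> V \<Longrightarrow> y \<in> V \<Longrightarrow> d x y = 0 \<longleftrightarrow> x = y"
  using d_isolated[of x y] wstep_pos[of "lev x"] d_self[of x] by fastforce

abbreviation "bd \<equiv> tree_boundary V E r"

lemma boundary:
  assumes "\<zeta> \<in> bd"
  shows "\<zeta> n \<in> V" "lev (\<zeta> n) = n" "(\<zeta> n, \<zeta> (Suc n)) \<in> E" "m \<le> n \<Longrightarrow> anc (\<zeta> n) m = \<zeta> m"
proof -
  have z: "\<zeta> 0 = r" "\<And>n. \<zeta> n \<in> V" "\<And>i j. i \<le> j \<Longrightarrow> gd (\<zeta> i) (\<zeta> j) = j - i"
    using assms by (auto simp: tree_boundary_def)
  show "\<zeta> n \<in> V" by (rule z)
  have l: "lev (\<zeta> n) = n" for n using z(3)[of 0 n] z(1) by simp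
  then show "lev (\<zeta> n) = n" .
  have e: "(\<zeta> n, \<zeta> (Suc n)) \<in> E" for n
    using gd_relpow[of "\<zeta> n" "\<zeta> (Suc n)"] z(2) z(3)[of n "Suc n"] by simp
  then show "(\<zeta> n, \<zeta> (Suc n)) \<in> E" .
  show "m \<le> n \<Longrightarrow> anc (\<zeta> n) m = \<zeta> m"
  proof (induction n)
    case 0
    then show ?case by (metis anc_self l le_zero_eq)
  next
    case (Suc n)
    show ?case
    proof (cases "m = Suc n")
      case True
      then show ?thesis by (metis anc_self l)
    next
      case False
      then show ?thesis using anc_child[OF e[of n], of m] l Suc by simp
    qed
  qed
qed

lemma meet_boundary: assumes "\<zeta> \<in> bd" shows "meet (\<zeta> n) (\<zeta> m) = min n m"
  by (rule meetI) (auto simp: le_meet boundary[OF assms])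

lemma d_boundary: assumes "\<zeta> \<in> bd" shows "d (\<zeta> n) (\<zeta> m) = \<bar>wt n - wt m\<bar>"
  using wt_le[of n m] wt_le[of m n]
  by (auto simp: d_eq meet_boundary[OF assms] boundary[OF assms] min_def)

abbreviation "cpl \<equiv> tree_completion V E r"
abbreviation "cd \<equiv> completion_dist V E r \<epsilon>"

lemma rep_seq_V: "p \<in> cpl \<Longrightarrow> rep_seq p n \<in> V"
  by (auto simp: tree_completion_def rep_seq_def boundary)

lemma rep_seq_Cauchy: "p \<in> cpl \<Longrightarrow> d (rep_seq p n) (rep_seq p m) \<le> \<bar>wt n - wt m\<bar>"
  by (auto simp: tree_completion_def rep_seq_def d_boundary d_self)

lemma cd_lim:
  assumes "p \<in> cpl" "q \<in> cpl"
  shows "(\<lambda>n. d (rep_seq p n) (rep_seq q n)) \<longlonglongrightarrow> cd p q"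
proof -
  let ?f = "\<lambda>n. d (rep_seq p n) (rep_seq q n)"
  have le: "?f n - ?f m \<le> 2 * \<bar>wt n - wt m\<bar>" for n m
  proof -
    have V: "rep_seq p n \<in> V" "rep_seq q n \<in> V" "rep_seq p m \<in> V" "rep_seq q m \<in> V"
      using rep_seq_V assms by auto
    have "d (rep_seq q m) (rep_seq q n) \<le> \<bar>wt n - wt m\<bar>"
      using rep_seq_Cauchy[OF assms(2), of m n] by (simp add: abs_minus_commute)
    then have "?f n \<le> \<bar>wt n - wt m\<bar> + (?f m + \<bar>wt n - wt m\<bar>)"
      by (intro order_trans[OF d_triangle[OF V(1) V(3) V(2)]] add_mono
          order_trans[OF d_triangle[OF V(3) V(4) V(2)]] rep_seq_Cauchy assms order_refl)
    then show ?thesis by simp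
  qed
  have "Cauchy wt" using wt_lim by (rule LIMSEQ_imp_Cauchy)
  have "Cauchy ?f"
  proof (rule metric_CauchyI)
    fix e :: real assume "e > 0"
    then obtain N where N: "\<And>m n. m \<ge> N \<Longrightarrow> n \<ge> N \<Longrightarrow> dist (wt m) (wt n) < e / 2"
      using metric_CauchyD[OF \<open>Cauchy wt\<close>, of "e / 2"] by auto
    have "dist (?f m) (?f n) < e" if "m \<ge> N" "n \<ge> N" for m n
      
    proof -
      have "2 * dist (wt m) (wt n) < e" using N[OF that] by simp
      then have "?f m - ?f n < e" "?f n - ?f m < e"
        using le[of m n] le[of n m] dist_commute[of "wt m" "wt n"] unfolding dist_real_def[of "wt _"]
        by (auto intro: le_less_trans)
      then show ?thesis by (simp add: dist_real_def abs_less_iff)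
    qed
    then show "\<exists>N. \<forall>m\<ge>N. \<forall>n\<ge>N. dist (?f m) (?f n) < e" by blast
  qed
  then have "convergent ?f" by (simp add: Cauchy_convergent_iff)
  then show ?thesis using assms by (simp add: completion_dist_def convergent_LIMSEQ_iff)
qed

lemma cd_eqI:
  "p \<in> cpl \<Longrightarrow> q \<in> cpl \<Longrightarrow> (\<lambda>n. d (rep_seq p n) (rep_seq q n)) \<longlonglongrightarrow> l \<Longrightarrow> cd p q = l"
  using LIMSEQ_unique cd_lim by blast

lemma Inl_cpl [simp]: "Inl x \<in> cpl \<longleftrightarrow> x \<in> V"
  and Inr_cpl [simp]: "Inr \<zeta> \<in> cpl \<longleftrightarrow> \<zeta> \<in> bd"
  by (auto simp: tree_completion_def)

lemma rep_seq_simps [simp]: "rep_seq (Inl x) = (\<lambda>n. x)" "rep_seq (Inr \<zeta>) = \<zeta>"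
  by (auto simp: rep_seq_def)

theorem completion_dist_vertices: "x \<in> V \<Longrightarrow> y \<in> V \<Longrightarrow> cd (Inl x) (Inl y) = d x y"
  by (rule cd_eqI) auto

theorem completion_dist_boundary:
  assumes "\<zeta> \<in> bd" "\<xi> \<in> bd"
  shows "cd (Inr \<zeta>) (Inr \<xi>) = visual_dist \<epsilon> \<zeta> \<xi>"
proof (rule cd_eqI)
  show "(\<lambda>n. d (rep_seq (Inr \<zeta>) n) (rep_seq (Inr \<xi>) n)) \<longlonglongrightarrow> visual_dist \<epsilon> \<zeta> \<xi>"
  proof (cases "\<zeta> = \<xi>")
    case True
    then show ?thesis using assms by (simp add: d_self boundary visual_dist_def)
  next
    case False
    define k where "k = (LEAST k. \<zeta> (Suc k) \<noteq> \<xi> (Suc k))"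
    have 0: "\<zeta> 0 = \<xi> 0" using assms by (auto simp: tree_boundary_def)
    from False obtain j where j: "\<zeta> j \<noteq> \<xi> j" by auto
    then obtain i where "j = Suc i" using 0 by (cases j) auto
    with j have "\<exists>k. \<zeta> (Suc k) \<noteq> \<xi> (Suc k)" by blast
    then have k1: "\<zeta> (Suc k) \<noteq> \<xi> (Suc k)" unfolding k_def by (rule LeastI_ex)
    have k2: "\<zeta> i = \<xi> i" if "i \<le> k" for i
      using that 0 not_less_Least[of "i - 1" "\<lambda>k. \<zeta> (Suc k) \<noteq> \<xi> (Suc k)", folded k_def]
      by (cases i) auto
    have iff: "\<zeta> i = \<xi> i \<longleftrightarrow> i \<le> k" for i
    proof
      assume eq: "\<zeta> i = \<xi> i"
      show "i \<le> k"
      proof (rule ccontr)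
        assume "\<not> i \<le> k"
        then have "\<zeta> (Suc k) = anc (\<zeta> i) (Suc k)" "\<xi> (Suc k) = anc (\<xi> i) (Suc k)"
          using boundary(4)[OF assms(1)] boundary(4)[OF assms(2)] by auto
        then show False using eq k1 by simp
      qed
    qed (rule k2)
    have m: "meet (\<zeta> n) (\<xi> n) = k" if "n \<ge> k" for n
    proof (rule meetI)
      fix j
      have V: "\<zeta> n \<in> V" "\<xi> n \<in> V" and l: "lev (\<zeta> n) = n" "lev (\<xi> n) = n"
        using boundary[OF assms(1)] boundary[OF assms(2)] by blast+
      show "j \<le> meet (\<zeta> n) (\<xi> n) \<longleftrightarrow> j \<le> k"
      proof (cases "j \<le> n")
        case True
        then show ?thesis
          unfolding le_meet[OF V] l boundary(4)[OF assms(1) True] boundary(4)[OF assms(2) True] iff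
          by simp
      next
        case False
        then show ?thesis unfolding le_meet[OF V] l using that by simp
      qed
    qed
    have "(\<lambda>n. 2 * (wt n - wt k)) \<longlonglongrightarrow> 2 * (1 / \<epsilon> - wt k)"
      by (intro tendsto_intros wt_lim)
    moreover have "\<forall>\<^sub>F n in sequentially. 2 * (wt n - wt k) = d (\<zeta> n) (\<xi> n)"
      using eventually_ge_at_top[of k]
      by eventually_elim (simp add: d_eq m boundary[OF assms(1)] boundary[OF assms(2)])
    moreover have "2 * (1 / \<epsilon> - wt k) = visual_dist \<epsilon> \<zeta> \<xi>"
      using False by (simp add: visual_dist_def k_def[symmetric] wt_def diff_divide_distrib)
    ultimately show ?thesis by (simp add: tendsto_cong)
  qed
qed (use assms in auto)

lemma cd_vertex_boundary: "\<zeta> \<in> bd \<Longrightarrow> x \<in> V \<Longrightarrow> (\<lambda>n. d x (\<zeta> n)) \<longlonglongrightarrow> cd (Inl x) (Inr \<zeta>)"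
  using cd_lim[of "Inl x" "Inr \<zeta>"] by simp

lemma cd_along_ray: "\<zeta> \<in> bd \<Longrightarrow> cd (Inl (\<zeta> n)) (Inr \<zeta>) = 1 / \<epsilon> - wt n"
proof (rule cd_eqI)
  assume z: "\<zeta> \<in> bd"
  have "(\<lambda>m. \<bar>wt n - wt m\<bar>) \<longlonglongrightarrow> \<bar>wt n - 1 / \<epsilon>\<bar>" by (intro tendsto_intros wt_lim)
  then show "(\<lambda>m. d (rep_seq (Inl (\<zeta> n)) m) (rep_seq (Inr \<zeta>) m)) \<longlonglongrightarrow> 1 / \<epsilon> - wt n"
    using wt_bound[of n] by (simp add: d_boundary[OF z])
qed (auto simp: boundary)

lemma cd_commute: "cd p q = cd q p"
proof (cases "p \<in> cpl \<and> q \<in> cpl")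
  case True
  then have "(\<lambda>n. d (rep_seq p n) (rep_seq q n)) = (\<lambda>n. d (rep_seq q n) (rep_seq p n))"
    using d_commute rep_seq_V by auto
  then show ?thesis using True by (simp add: completion_dist_def)
qed (auto simp: completion_dist_def)

lemma cd_pos_vertex_boundary:
  assumes "\<zeta> \<in> bd" "x \<in> V" shows "cd (Inl x) (Inr \<zeta>) > 0"
proof -
  have "1 / \<epsilon> - wt (lev x) \<le> cd (Inl x) (Inr \<zeta>)"
  proof (rule LIMSEQ_le)
    show "(\<lambda>n. wt n - wt (lev x)) \<longlonglongrightarrow> 1 / \<epsilon> - wt (lev x)" by (intro tendsto_intros wt_lim)
    show "(\<lambda>n. d x (\<zeta> n)) \<longlonglongrightarrow> cd (Inl x) (Inr \<zeta>)" using cd_vertex_boundary assms by simp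
    show "\<exists>N. \<forall>n\<ge>N. wt n - wt (lev x) \<le> d x (\<zeta> n)"
      using d_ge_lev[OF assms(2) boundary(1)[OF assms(1)]] boundary(2)[OF assms(1)] by simp
  qed
  then show ?thesis using wt_bound[of "lev x"] by simp
qed

lemma visual_dist_pos: "\<zeta> \<noteq> \<xi> \<Longrightarrow> visual_dist \<epsilon> \<zeta> \<xi> > 0"
  using eps_pos by (simp add: visual_dist_def)

theorem Metric_space_completion: "Metric_space cpl cd"
proof
  fix p q
  show "0 \<le> cd p q"
  proof (cases "p \<in> cpl \<and> q \<in> cpl")
    case True
    then show ?thesis
      using LIMSEQ_le_const[OF cd_lim[of p q], of 0] d_nonneg rep_seq_V by blast
  qed (auto simp: completion_dist_def)
  show "cd p q = cd q p" by (rule cd_commute)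
next
  fix p q assume pq: "p \<in> cpl" "q \<in> cpl"
  have "cd p p = 0" if "p \<in> cpl" for p
    by (rule cd_eqI) (use that rep_seq_V d_self in auto)
  moreover have "p = q" if "cd p q = 0"
  proof (cases p)
    case p: (Inl x)
    show ?thesis
    proof (cases q)
      case (Inl y)
      then show ?thesis using p that pq d_eq_0[of x y] completion_dist_vertices[of x y] by simp
    next
      case (Inr \<xi>)
      then show ?thesis using p that pq cd_pos_vertex_boundary[of \<xi> x] by simp
    qed
  next
    case p: (Inr \<zeta>)
    show ?thesis
    proof (cases q)
      case (Inl y)
      then show ?thesis using p that pq cd_pos_vertex_boundary[of \<zeta> y] cd_commute[of p q] by simp
    next
      case (Inr \<xi>)
      then show ?thesis
        using p that pq completion_dist_boundary[of \<zeta> \<xi>] visual_dist_pos[of \<zeta> \<xi>] by auto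
    qed
  qed
  ultimately show "cd p q = 0 \<longleftrightarrow> p = q" using pq by blast
next
  fix p q s assume a: "p \<in> cpl" "q \<in> cpl" "s \<in> cpl"
  show "cd p s \<le> cd p q + cd q s"
  proof (rule LIMSEQ_le)
    show "(\<lambda>n. d (rep_seq p n) (rep_seq s n)) \<longlonglongrightarrow> cd p s" using cd_lim a by simp
    show "(\<lambda>n. d (rep_seq p n) (rep_seq q n) + d (rep_seq q n) (rep_seq s n))
        \<longlonglongrightarrow> cd p q + cd q s" using cd_lim a by (intro tendsto_add) simp_all
    show "\<exists>N. \<forall>n\<ge>N. d (rep_seq p n) (rep_seq s n)
        \<le> d (rep_seq p n) (rep_seq q n) + d (rep_seq q n) (rep_seq s n)"
      using d_triangle rep_seq_V a by blast
  qed
qed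

theorem Metric_space_boundary: "Metric_space bd (visual_dist \<epsilon>)"
proof
  interpret C: Metric_space cpl cd by (rule Metric_space_completion)
  fix x y :: "nat \<Rightarrow> 'a"
  show "0 \<le> visual_dist \<epsilon> x y" using eps_pos by (simp add: visual_dist_def)
  have "(\<lambda>k. x (Suc k) \<noteq> y (Suc k)) = (\<lambda>k. y (Suc k) \<noteq> x (Suc k))" by auto
  then show "visual_dist \<epsilon> x y = visual_dist \<epsilon> y x" by (simp add: visual_dist_def)
  show "visual_dist \<epsilon> x y = 0 \<longleftrightarrow> x = y"
    using visual_dist_pos[of x y] by (auto simp: visual_dist_def)
  fix z assume "x \<in> bd" "y \<in> bd" "z \<in> bd"
  then show "visual_dist \<epsilon> x z \<le> visual_dist \<epsilon> x y + visual_dist \<epsilon> y z"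
    using C.triangle[of "Inr x" "Inr y" "Inr z"] by (simp add: completion_dist_boundary)
qed

sublocale C: Metric_space cpl cd by (rule Metric_space_completion)
sublocale B: Metric_space bd "visual_dist \<epsilon>" by (rule Metric_space_boundary)

lemma vertices_dense_ex: assumes "p \<in> cpl" "e > 0" shows "\<exists>x\<in>V. cd p (Inl x) < e"
proof (cases p)
  case (Inl x)
  then have "x \<in> V" "cd p (Inl x) < e" using assms C.zero[of p p] by auto
  then show ?thesis by blast
next
  case (Inr \<zeta>)
  then have z: "\<zeta> \<in> bd" using assms by simp
  have "(\<lambda>n. 1 / \<epsilon> - wt n) \<longlonglongrightarrow> 1 / \<epsilon> - 1 / \<epsilon>" by (intro tendsto_intros wt_lim)
  then have "(\<lambda>n. 1 / \<epsilon> - wt n) \<longlonglongrightarrow> 0" by simp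
  then have "\<forall>\<^sub>F n in sequentially. 1 / \<epsilon> - wt n < e" using assms by (intro order_tendstoD)
  then obtain n where "1 / \<epsilon> - wt n < e" by (auto simp: eventually_sequentially)
  then have "cd p (Inl (\<zeta> n)) < e" using cd_along_ray[OF z] Inr cd_commute by metis
  then show ?thesis using boundary(1)[OF z] by blast
qed

theorem vertices_dense: "C.mtopology closure_of (Inl ` V) = cpl"
  unfolding C.metric_closure_of using vertices_dense_ex by (force simp: C.in_mball)

lemma vertex_Cauchy_limit:
  fixes x :: "nat \<Rightarrow> 'a"
  assumes V: "\<And>n. x n \<in> V"
    and Cauchy: "\<And>e. e > 0 \<Longrightarrow> \<exists>N. \<forall>m\<ge>N. \<forall>n\<ge>N. d (x m) (x n) < e"
  shows "\<exists>p\<in>cpl. \<forall>e>0. \<exists>N. \<forall>n\<ge>N. cd (Inl (x n)) p < e"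
proof (cases "\<exists>k. \<forall>N. \<exists>n\<ge>N. lev (x n) \<le> k")
  case True
  then obtain k where k: "\<And>N. \<exists>n\<ge>N. lev (x n) \<le> k" by blast
  obtain N where N: "\<And>m n. m \<ge> N \<Longrightarrow> n \<ge> N \<Longrightarrow> d (x m) (x n) < wstep k"
    using Cauchy[OF wstep_pos[of k]] by blast
  obtain m where m: "m \<ge> N" "lev (x m) \<le> k" using k by blast
  have "x n = x m" if "n \<ge> N" for n
    using d_isolated[OF V V, of m n] N[OF m(1) that] wstep_antimono[OF m(2)] by fastforce
  then have "cd (Inl (x n)) (Inl (x m)) = 0" if "n \<ge> N" for n using that V by simp
  then have "\<forall>e>0. \<exists>N. \<forall>n\<ge>N. cd (Inl (x n)) (Inl (x m)) < e" by metis
  then show ?thesis using V by (intro bexI[of _ "Inl (x m)"]) simp_all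
next
  case False
  have "\<exists>N. \<forall>n\<ge>N. \<forall>m\<ge>N. k \<le> meet (x n) (x m)" for k
  proof -
    obtain N1 where N1: "\<And>m n. m \<ge> N1 \<Longrightarrow> n \<ge> N1 \<Longrightarrow> d (x m) (x n) < wstep k"
      using Cauchy[OF wstep_pos[of k]] by blast
    obtain N2 where N2: "\<And>n. n \<ge> N2 \<Longrightarrow> k < lev (x n)" using False by (meson not_less)
    have "k \<le> meet (x n) (x m)" if "n \<ge> max N1 N2" "m \<ge> max N1 N2" for n m
    proof (rule ccontr)
      assume "\<not> k \<le> meet (x n) (x m)"
      then have "meet (x n) (x m) < k" by simp
      moreover have "k < lev (x n)" using N2[of n] that by simp
      ultimately have "wstep k \<le> wt (lev (x n)) - wt (meet (x n) (x m))"
        by (intro wt_diff) linarith+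
      moreover have "d (x n) (x m) < wstep k" using N1[of n m] that by simp
      ultimately show False using d_ge[OF V V, of n m] by linarith
    qed
    then show ?thesis by blast
  qed
  then obtain N where N: "\<And>k n m. n \<ge> N k \<Longrightarrow> m \<ge> N k \<Longrightarrow> k \<le> meet (x n) (x m)" by metis
  define \<zeta> where "\<zeta> k = anc (x (N k)) k" for k
  have L: "k \<le> lev (x n)" "anc (x n) k = \<zeta> k" if "n \<ge> N k" for n k
    using N[OF that, of "N k"] le_meet[OF V V] by (auto simp: \<zeta>_def)
  have z: "\<zeta> \<in> bd"
  proof -
    have "\<zeta> 0 = r" using anc_0[OF V] by (simp add: \<zeta>_def)
    moreover have zV: "\<zeta> k \<in> V" "lev (\<zeta> k) = k" for k
      using anc[OF V L(1)[of k "N k"]] by (auto simp: \<zeta>_def)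
    moreover have "gd (\<zeta> i) (\<zeta> j) = j - i" if "i \<le> j" for i j
    proof -
      define n where "n = max (N i) (N j)"
      have n: "anc (x n) i = \<zeta> i" "anc (x n) j = \<zeta> j" "j \<le> lev (x n)"
        using L[of i n] L[of j n] by (auto simp: n_def)
      have a: "anc (\<zeta> i) k = anc (x n) k" if "k \<le> i" for k
        using anc_anc[OF V, of k i n] n that \<open>i \<le> j\<close> by simp
      have b: "anc (\<zeta> j) k = anc (x n) k" if "k \<le> j" for k
        using anc_anc[OF V, of k j n] n that by simp
      have "meet (\<zeta> i) (\<zeta> j) = i"
        by (rule meetI) (use a b that in \<open>auto simp: le_meet zV\<close>)
      then show ?thesis using gd_eq_hdist[OF zV(1) zV(1), of i j] that by (simp add: hdist_def zV)
    qed
    ultimately show ?thesis unfolding tree_boundary_def by auto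
  qed
  have bound: "cd (Inl (x n)) (Inr \<zeta>) \<le> 2 * (1 / \<epsilon> - wt k)" if "n \<ge> N k" for n k
  proof (rule LIMSEQ_le_const2[OF cd_vertex_boundary[OF z V]], intro exI allI impI)
    fix m assume m: "k \<le> m"
    have "k \<le> meet (x n) (\<zeta> m)"
      using le_meet[OF V boundary(1)[OF z]] L[OF that] boundary[OF z] m by simp
    then have "wt k \<le> wt (meet (x n) (\<zeta> m))" by (rule wt_le)
    then show "d (x n) (\<zeta> m) \<le> 2 * (1 / \<epsilon> - wt k)"
      unfolding d_eq[OF V boundary(1)[OF z]] mult_2
      by (intro add_mono diff_mono less_imp_le[OF wt_bound])
  qed
  show ?thesis
  proof (intro bexI[of _ "Inr \<zeta>"] allI impI)
    fix e :: real assume "e > 0"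
    have "(\<lambda>k. 2 * (1 / \<epsilon> - wt k)) \<longlonglongrightarrow> 2 * (1 / \<epsilon> - 1 / \<epsilon>)" by (intro tendsto_intros wt_lim)
    then have "(\<lambda>k. 2 * (1 / \<epsilon> - wt k)) \<longlonglongrightarrow> 0" by simp
    then have "\<forall>\<^sub>F k in sequentially. 2 * (1 / \<epsilon> - wt k) < e"
      using \<open>e > 0\<close> by (intro order_tendstoD)
    then obtain k where "2 * (1 / \<epsilon> - wt k) < e" by (auto simp: eventually_sequentially)
    then show "\<exists>N. \<forall>n\<ge>N. cd (Inl (x n)) (Inr \<zeta>) < e" using bound[of k] le_less_trans by blast
  qed (use z in auto)
qed

theorem completion_complete: "C.mcomplete"
  unfolding C.mcomplete_def
proof (intro allI impI)
  fix \<sigma> assume s: "C.MCauchy \<sigma>"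
  have sM: "\<sigma> n \<in> cpl" for n using s unfolding C.MCauchy_def by auto
  have "\<exists>x\<in>V. cd (\<sigma> n) (Inl x) < 1 / real (Suc n)" for n
    by (rule vertices_dense_ex[OF sM]) simp
  then obtain x where x: "\<And>n. x n \<in> V" "\<And>n. cd (\<sigma> n) (Inl (x n)) < 1 / real (Suc n)" by metis
  have small: "\<exists>N. \<forall>n\<ge>N. cd (\<sigma> n) (Inl (x n)) < e" if "e > 0" for e
  proof -
    obtain N where N: "1 / real (Suc N) < e" using nat_approx_posE[OF \<open>e > 0\<close>] by blast
    have "cd (\<sigma> n) (Inl (x n)) < e" if "n \<ge> N" for n
    proof -
      have "1 / real (Suc n) \<le> 1 / real (Suc N)" using that by (simp add: frac_le)
      then show ?thesis using x(2)[of n] N by linarith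
    qed
    then show ?thesis by blast
  qed
  have "\<exists>N. \<forall>m\<ge>N. \<forall>n\<ge>N. d (x m) (x n) < e" if "e > 0" for e
  proof -
    obtain N1 where N1: "\<And>n. n \<ge> N1 \<Longrightarrow> cd (\<sigma> n) (Inl (x n)) < e / 3"
      using small[of "e / 3"] \<open>e > 0\<close> by auto
    obtain N2 where N2: "\<And>m n. m \<ge> N2 \<Longrightarrow> n \<ge> N2 \<Longrightarrow> cd (\<sigma> m) (\<sigma> n) < e / 3"
      using s \<open>e > 0\<close> unfolding C.MCauchy_def by (meson divide_pos_pos zero_less_numeral)
    have "d (x m) (x n) < e" if "m \<ge> max N1 N2" "n \<ge> max N1 N2" for m n
    proof -
      have "cd (Inl (x m)) (Inl (x n)) \<le> cd (Inl (x m)) (\<sigma> m) + cd (\<sigma> m) (Inl (x n))"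
        using C.triangle sM x by simp
      also have "cd (\<sigma> m) (Inl (x n)) \<le> cd (\<sigma> m) (\<sigma> n) + cd (\<sigma> n) (Inl (x n))"
        using C.triangle sM x by simp
      finally show ?thesis
        using N1[of m] N1[of n] N2[of m n] that cd_commute[of "Inl (x m)" "\<sigma> m"]
          completion_dist_vertices[OF x(1) x(1), of m n] by simp
    qed
    then show ?thesis by blast
  qed
  from vertex_Cauchy_limit[OF x(1) this]
  obtain p where p: "p \<in> cpl" "\<And>e. e > 0 \<Longrightarrow> \<exists>N. \<forall>n\<ge>N. cd (Inl (x n)) p < e" by blast
  have "\<exists>N. \<forall>n\<ge>N. cd (\<sigma> n) p < e" if "e > 0" for e
  proof -
    obtain N1 where N1: "\<And>n. n \<ge> N1 \<Longrightarrow> cd (\<sigma> n) (Inl (x n)) < e / 2"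
      using small[of "e / 2"] \<open>e > 0\<close> by auto
    obtain N2 where N2: "\<And>n. n \<ge> N2 \<Longrightarrow> cd (Inl (x n)) p < e / 2"
      using p(2)[of "e / 2"] \<open>e > 0\<close> by auto
    have "cd (\<sigma> n) p < e" if "n \<ge> max N1 N2" for n
      using C.triangle[of "\<sigma> n" "Inl (x n)" p] N1[of n] N2[of n] that sM[of n] x(1)[of n] p(1)
      by simp
    then show ?thesis by blast
  qed
  then have "limitin C.mtopology \<sigma> p sequentially"
    unfolding C.limit_metric_sequentially using sM p(1) by simp
  then show "\<exists>l. limitin C.mtopology \<sigma> l sequentially" ..
qed

end

end

theory Submission
  imports Defs
begin

text \<open>
  Write \<open>k\<close> for the number of edges shared by the rays \<open>\<zeta>, \<xi>\<close> in \<open>X\<close> (\<open>branch_level\<close>) and \<open>k'\<close> for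
  the number shared by \<open>f \<zeta>, f \<xi>\<close> in \<open>Y\<close>. Visual distances are exponentials of branch levels,
  so quasisymmetry compares the difference of two branch levels on a common ray \<open>\<zeta>\<close> with the
  difference of the corresponding branch levels on \<open>f \<zeta>\<close>; additive errors in this comparison only
  change the constant \<open>A\<close>.

  The key fact is that \<open>F\<close> maps the vertex \<open>\<zeta> k\<close>, where the rays \<open>\<zeta>\<close> and \<open>\<xi>\<close> separate, to within
  bounded distance of the vertex \<open>f \<zeta> k'\<close>, where the image rays separate
  (\<open>image_branch_vertex\<close>). The reason is that a sequence of vertices in a tree with bounded
  jumps cannot enter the subtree below a vertex \<open>v\<close> without coming close to \<open>v\<close> (\<open>path_enters_subtree\<close>). Hence both image paths \<open>F (\<zeta> i)\<close> and \<open>F (\<xi> i)\<close>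
  come close to \<open>f \<zeta> k'\<close>, and one of them still does so at a time \<open>n \<ge> k\<close>, because \<open>F (\<zeta> k)\<close>
  cannot lie beyond the branching of \<open>f \<zeta>\<close> and \<open>f \<xi>\<close> in both directions. After time \<open>k\<close> the two
  rays in \<open>X\<close> diverge at unit speed, and by the lower bound for \<open>F\<close> two points of them with nearby
  images are close, so \<open>n - k\<close> is bounded.

  Applying this to two pairs of rays and using the bounds for \<open>F\<close> along \<open>\<zeta>\<close> gives
  \<open>L\<^sub>1 g - C \<le> g' \<le> L\<^sub>2 g + C\<close> for the absolute differences \<open>g, g'\<close> of the branch levels
  (\<open>branch_level_gap\<close>). The crossing argument also shows that the order of two branch levels can
  only be reversed when they are boundedly close (\<open>branch_order_almost_preserved\<close>), which
  gives the signed estimate \<open>branch_level_control\<close> and thus the exponent \<open>\<alpha>\<^sub>1\<close> for ratios at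
  most \<open>1\<close> and \<open>\<alpha>\<^sub>2\<close> for ratios at least \<open>1\<close>.

  That \<open>f\<close> is a homeomorphism follows since \<open>f\<close> and its inverse are Hoelder continuous. For
  surjectivity, coarse preimages of the vertices on a ray of \<open>Y\<close> form a sequence with bounded
  jumps that leaves every ball, and such a sequence converges to a boundary point
  (\<open>bounded_jumps_converges\<close>). This also shows that \<open>f\<close> is well defined.
\<close>

section \<open>Rays, subtrees and coarse paths in a tree\<close>

context weighted_tree
begin

definition below :: "'a \<Rightarrow> 'a \<Rightarrow> bool" where
  "below v x \<longleftrightarrow> lev v \<le> lev x \<and> anc x (lev v) = v"

definition branch_level :: "(nat \<Rightarrow> 'a) \<Rightarrow> (nat \<Rightarrow> 'a) \<Rightarrow> nat" where
  "branch_level \<zeta> \<xi> = (LEAST k. \<zeta> (Suc k) \<noteq> \<xi> (Suc k))"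

text \<open>
  The vertices \<open>p i\<close> converge to the boundary point \<open>\<omega>\<close> in the completion of the tree: the subtrees
  below the vertices of \<open>\<omega>\<close> form a neighbourhood basis of \<open>\<omega>\<close>.
\<close>

definition converges_to :: "(nat \<Rightarrow> 'a) \<Rightarrow> (nat \<Rightarrow> 'a) \<Rightarrow> bool" where
  "converges_to p \<omega> \<longleftrightarrow> (\<forall>k. \<forall>\<^sub>F i in sequentially. below (\<omega> k) (p i))"

lemma gd_meet: "x \<in> V \<Longrightarrow> y \<in> V \<Longrightarrow> gd x y + 2 * meet x y = lev x + lev y"
  using gd_eq_hdist[of x y] by (simp add: hdist_def)

lemma below_iff_meet:
  assumes "x \<in> V" "v \<in> V"
  shows "below v x \<longleftrightarrow> meet v x = lev v"
proof -
  have "below v x \<longleftrightarrow> lev v \<le> meet v x"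
    unfolding le_meet[OF assms(2,1)] below_def by auto
  then show ?thesis using meet_le(1)[OF assms(2,1)] by auto
qed

lemma gd_below: "x \<in> V \<Longrightarrow> v \<in> V \<Longrightarrow> below v x \<Longrightarrow> gd v x = lev x - lev v"
  using gd_meet[of v x] below_iff_meet[of x v] by simp

lemma below_le_meet:
  assumes "x \<in> V" "y \<in> V" "below v x"
  shows "below v y \<longleftrightarrow> lev v \<le> meet x y"
  using le_meet[OF assms(1,2), of "lev v"] assms(3) by (auto simp: below_def)

text \<open>
  The subtree below \<open>v\<close> is attached to the rest of the tree only at \<open>v\<close>, so a geodesic entering
  the subtree runs through \<open>v\<close>.
\<close>

lemma gd_enter_subtree:
  assumes "x \<in> V" "y \<in> V" "v \<in> V" "below v x" "\<not> below v y"
  shows "gd v x \<le> gd x y"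
proof -
  have "meet x y < lev v" using below_le_meet[OF assms(1,2,4)] assms(5) by simp
  then show ?thesis
    using gd_meet[OF assms(1,2)] gd_below[OF assms(1,3,4)] meet_le[OF assms(1,2)] by simp
qed

lemma boundary_below_iff:
  assumes "\<zeta> \<in> bd"
  shows "below (\<zeta> k) x \<longleftrightarrow> k \<le> lev x \<and> anc x k = \<zeta> k"
  by (simp add: below_def boundary(2)[OF assms])

lemma boundary_below_mono:
  assumes "\<zeta> \<in> bd" "x \<in> V" "j \<le> k" "below (\<zeta> k) x"
  shows "below (\<zeta> j) x"
  using assms anc_anc[of x j k] boundary(4)[OF assms(1,3)]
  unfolding boundary_below_iff[OF assms(1)] by auto

lemma branch_level_eq_iff:
  assumes "\<zeta> \<in> bd" "\<xi> \<in> bd" "\<zeta> \<noteq> \<xi>"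
  shows "\<zeta> i = \<xi> i \<longleftrightarrow> i \<le> branch_level \<zeta> \<xi>"
proof -
  have 0: "\<zeta> 0 = \<xi> 0" using assms by (auto simp: tree_boundary_def)
  obtain j where "\<zeta> j \<noteq> \<xi> j" using assms(3) by auto
  then have "\<exists>k. \<zeta> (Suc k) \<noteq> \<xi> (Suc k)" using 0 by (cases j) auto
  then have neq: "\<zeta> (Suc (branch_level \<zeta> \<xi>)) \<noteq> \<xi> (Suc (branch_level \<zeta> \<xi>))"
    unfolding branch_level_def by (rule LeastI_ex)
  show ?thesis
  proof
    assume eq: "\<zeta> i = \<xi> i"
    show "i \<le> branch_level \<zeta> \<xi>"
    proof (rule ccontr)
      assume "\<not> i \<le> branch_level \<zeta> \<xi>"
      then show False
        using neq eq boundary(4)[OF assms(1), of "Suc (branch_level \<zeta> \<xi>)" i]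
          boundary(4)[OF assms(2), of "Suc (branch_level \<zeta> \<xi>)" i] by simp
    qed
  next
    assume "i \<le> branch_level \<zeta> \<xi>"
    then show "\<zeta> i = \<xi> i"
      using 0 not_less_Least[of "i - 1" "\<lambda>k. \<zeta> (Suc k) \<noteq> \<xi> (Suc k)"]
      by (cases i) (auto simp: branch_level_def)
  qed
qed

lemma visual_dist_branch_level:
  "\<zeta> \<noteq> \<xi> \<Longrightarrow> visual_dist \<epsilon> \<zeta> \<xi> = 2 / \<epsilon> * exp (- \<epsilon> * real (branch_level \<zeta> \<xi>))"
  by (simp add: visual_dist_def branch_level_def)

lemma branch_level_commute: "branch_level \<zeta> \<xi> = branch_level \<xi> \<zeta>"
  by (simp add: branch_level_def eq_commute)

text \<open>
  After the branching, a ray moves away from every vertex of the other ray at unit speed.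
\<close>

lemma gd_after_branching:
  assumes "\<zeta> \<in> bd" "\<xi> \<in> bd" "\<zeta> \<noteq> \<xi>"
  shows "i \<le> gd (\<zeta> i) (\<xi> j) + branch_level \<zeta> \<xi>"
proof -
  let ?k = "branch_level \<zeta> \<xi>"
  have V: "\<zeta> i \<in> V" "\<xi> j \<in> V" and l: "lev (\<zeta> i) = i" "lev (\<xi> j) = j"
    using boundary[OF assms(1)] boundary[OF assms(2)] by blast+
  have "\<not> Suc ?k \<le> meet (\<zeta> i) (\<xi> j)"
    using branch_level_eq_iff[OF assms, of "Suc ?k"]
      boundary(4)[OF assms(1), of "Suc ?k" i] boundary(4)[OF assms(2), of "Suc ?k" j]
    unfolding le_meet[OF V] l by auto
  then show ?thesis using gd_meet[OF V] l meet_le[OF V] by simp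
qed

lemma gd_along_boundary: "\<zeta> \<in> bd \<Longrightarrow> real (gd (\<zeta> i) (\<zeta> j)) = \<bar>real i - real j\<bar>"
  using gd_meet[of "\<zeta> i" "\<zeta> j"] by (simp add: boundary meet_boundary min_def split: if_splits)

text \<open>
  At the step at which the path first enters the subtree below \<open>v\<close>, it jumps over \<open>v\<close>; the
  distance to \<open>v\<close> is then at most the length of that jump.
\<close>

lemma path_enters_subtree:
  assumes V: "\<And>i. p i \<in> V" "v \<in> V"
    and jump: "\<And>i. real (gd (p i) (p (Suc i))) \<le> J"
    and out: "\<not> below v (p m)" and ev: "\<forall>\<^sub>F i in sequentially. below v (p i)"
  shows "\<exists>i\<ge>m. real (gd (p i) v) \<le> J"
proof -
  obtain N where N: "\<And>i. i \<ge> N \<Longrightarrow> below v (p i)" using ev by (auto simp: eventually_sequentially)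
  define n where "n = (LEAST i. m \<le> i \<and> below v (p i))"
  have "m \<le> max m N \<and> below v (p (max m N))" using N by simp
  then have n: "m \<le> n" "below v (p n)" unfolding n_def by (metis (mono_tags, lifting) LeastI)+
  then have "m < n" using out by (metis le_neq_implies_less)
  then obtain i where i: "n = Suc i" "m \<le> i" by (cases n) auto
  then have "\<not> below v (p i)"
    using not_less_Least[of i "\<lambda>i. m \<le> i \<and> below v (p i)"] by (auto simp: n_def)
  then have "gd v (p n) \<le> gd (p n) (p i)" using gd_enter_subtree V n by blast
  then have "real (gd (p n) v) \<le> J" using jump[of i] i gd_commute V by (simp add: order_trans)
  then show ?thesis using n by blast
qed

text \<open>
  Either the path enters the subtree below \<open>\<omega> k\<close> at some time, or it starts there, and then
  \<open>\<omega> k\<close> lies on the geodesic from the root to \<open>p 0\<close>.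
\<close>

lemma converges_to_passes_near:
  assumes "\<And>i. p i \<in> V" "\<And>i. real (gd (p i) (p (Suc i))) \<le> J"
    and "\<omega> \<in> bd" "converges_to p \<omega>"
  shows "\<exists>i. real (gd (p i) (\<omega> k)) \<le> J + real (lev (p 0))"
proof -
  have J: "0 \<le> J" using assms(2)[of 0] by linarith
  show ?thesis
  proof (cases "below (\<omega> k) (p 0)")
    case True
    then have "gd (p 0) (\<omega> k) \<le> lev (p 0)"
      using gd_below[of "p 0" "\<omega> k"] gd_commute[of "p 0" "\<omega> k"] assms(1) boundary[OF assms(3)]
      by simp
    then have "real (gd (p 0) (\<omega> k)) \<le> J + real (lev (p 0))" using J by linarith
    then show ?thesis by blast
  next
    case False
    obtain i where "real (gd (p i) (\<omega> k)) \<le> J"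
      using path_enters_subtree[OF assms(1) boundary(1)[OF assms(3)] assms(2) False] assms(4)
      by (auto simp: converges_to_def)
    then have "real (gd (p i) (\<omega> k)) \<le> J + real (lev (p 0))" by linarith
    then show ?thesis by blast
  qed
qed

text \<open>
  Once the path stays at levels above \<open>k + J\<close>, a jump of length at most \<open>J\<close> cannot change the
  ancestor at level \<open>k\<close>. The ancestors are therefore eventually constant at each level, and these
  constants form the limiting ray.
\<close>

lemma bounded_jumps_converges:
  assumes V: "\<And>i. p i \<in> V" and jump: "\<And>i. real (gd (p i) (p (Suc i))) \<le> J"
    and lev: "filterlim (\<lambda>i. real (lev (p i))) at_top sequentially"
  shows "\<exists>\<omega>\<in>bd. converges_to p \<omega>"
proof -
  have "\<exists>N. \<forall>i\<ge>N. k \<le> lev (p i) \<and> anc (p i) k = anc (p N) k" for k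
  proof -
    have "\<forall>\<^sub>F i in sequentially. real k + J < real (lev (p i))"
      using lev by (simp add: filterlim_at_top_dense)
    then obtain N where N: "\<And>i. i \<ge> N \<Longrightarrow> real k + J < real (lev (p i))"
      by (auto simp: eventually_sequentially)
    have J: "0 \<le> J" using jump[of 0] by linarith
    have kl: "k \<le> lev (p i)" if "i \<ge> N" for i using N[OF that] J by linarith
    have step: "anc (p (Suc i)) k = anc (p i) k" if "i \<ge> N" for i
    proof -
      have "k \<le> meet (p i) (p (Suc i))"
        using gd_meet[OF V V, of i "Suc i"] meet_le(2)[OF V V, of i "Suc i"] jump[of i] N[OF that]
        by linarith
      then show ?thesis using le_meet[OF V V] by metis
    qed
    have "anc (p i) k = anc (p N) k" if "i \<ge> N" for i
      using that by (induction i rule: dec_induct) (simp_all add: step)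
    then show ?thesis using kl by blast
  qed
  then obtain N where N: "\<And>k i. i \<ge> N k \<Longrightarrow> k \<le> lev (p i)"
      "\<And>k i. i \<ge> N k \<Longrightarrow> anc (p i) k = anc (p (N k)) k" by metis
  define \<omega> where "\<omega> k = anc (p (N k)) k" for k
  have wV: "\<omega> k \<in> V" "lev (\<omega> k) = k" for k
    using anc[OF V N(1)[of k "N k"]] by (auto simp: \<omega>_def)
  have "gd (\<omega> i) (\<omega> j) = j - i" if "i \<le> j" for i j
  proof -
    define n where "n = max (N i) (N j)"
    have n: "anc (p n) i = \<omega> i" "anc (p n) j = \<omega> j" "j \<le> lev (p n)"
      using N[of i n] N[of j n] by (auto simp: n_def \<omega>_def)
    then have "anc (\<omega> j) i = \<omega> i" using anc_anc[OF V, of i j n] that by simp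
    then show ?thesis using gd_below[OF wV(1) wV(1), of i j] that by (simp add: below_def wV)
  qed
  moreover have "\<omega> 0 = r" using anc_0[OF V] by (simp add: \<omega>_def)
  ultimately have w: "\<omega> \<in> bd" using wV unfolding tree_boundary_def by auto
  have "below (\<omega> k) (p i)" if "i \<ge> N k" for i k
    unfolding boundary_below_iff[OF w] unfolding \<omega>_def using N(1)[OF that] N(2)[OF that] by (rule conjI)
  then have "\<forall>\<^sub>F i in sequentially. below (\<omega> k) (p i)" for k
    unfolding eventually_sequentially by blast
  then show ?thesis using w by (auto simp: converges_to_def)
qed

text \<open>
  A vertex outside the subtree below \<open>\<xi> k\<close> has distance at least \<open>1 / \<epsilon> - wt k\<close> from \<open>\<xi>\<close>, and a
  vertex inside has distance at most twice this number, which tends to \<open>0\<close>.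
\<close>

lemma boundary_point_in_closure_iff:
  assumes "\<xi> \<in> bd" "S \<subseteq> V"
  shows "Inr \<xi> \<in> C.mtopology closure_of (Inl ` S) \<longleftrightarrow> (\<forall>k. \<exists>x\<in>S. below (\<xi> k) x)"
proof
  assume cl: "Inr \<xi> \<in> C.mtopology closure_of (Inl ` S)"
  show "\<forall>k. \<exists>x\<in>S. below (\<xi> k) x"
  proof
    fix k
    have "0 < 1 / \<epsilon> - wt k" using wt_bound[of k] by simp
    then obtain x where x: "x \<in> S" "cd (Inr \<xi>) (Inl x) < 1 / \<epsilon> - wt k"
      using cl unfolding C.metric_closure_of by (auto simp: C.in_mball simp del: diff_gt_0_iff_gt)
    have xV: "x \<in> V" using x assms by blast
    have "below (\<xi> k) x"
    proof (rule ccontr)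
      assume nb: "\<not> below (\<xi> k) x"
      \<comment> \<open>\<open>x\<close> branches off \<open>\<xi>\<close> before level \<open>k\<close>, so the geodesic to \<open>\<xi> n\<close> contains \<open>\<xi> k, \<dots>, \<xi> n\<close>\<close>
      have "wt n - wt k \<le> d x (\<xi> n)" if "n \<ge> k" for n
      proof -
        have "below (\<xi> k) (\<xi> n)"
          using boundary[OF assms(1)] that by (simp add: boundary_below_iff[OF assms(1)])
        then have "meet x (\<xi> n) < k"
          using below_le_meet[of "\<xi> n" x "\<xi> k"] nb xV boundary[OF assms(1)] meet_commute[of x "\<xi> n"]
          by simp
        then have "wt (meet x (\<xi> n)) \<le> wt k" by (intro wt_le) simp
        then show ?thesis
          using d_ge[OF boundary(1)[OF assms(1)] xV, of n] boundary(2)[OF assms(1)]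
            d_commute[OF xV boundary(1)[OF assms(1)], of n] meet_commute[of x "\<xi> n"] by simp
      qed
      moreover have "(\<lambda>n. wt n - wt k) \<longlonglongrightarrow> 1 / \<epsilon> - wt k" by (intro tendsto_intros wt_lim)
      ultimately have "1 / \<epsilon> - wt k \<le> cd (Inl x) (Inr \<xi>)"
        using LIMSEQ_le[OF _ cd_vertex_boundary[OF assms(1) xV]] by blast
      then show False using x(2) cd_commute[of "Inl x" "Inr \<xi>"] by simp
    qed
    then show "\<exists>x\<in>S. below (\<xi> k) x" using x by blast
  qed
next
  assume b: "\<forall>k. \<exists>x\<in>S. below (\<xi> k) x"
  have "\<exists>x\<in>S. cd (Inr \<xi>) (Inl x) < e" if "e > 0" for e
  proof -
    have "(\<lambda>k. 2 * (1 / \<epsilon> - wt k)) \<longlonglongrightarrow> 2 * (1 / \<epsilon> - 1 / \<epsilon>)" by (intro tendsto_intros wt_lim)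
    then have "\<forall>\<^sub>F k in sequentially. 2 * (1 / \<epsilon> - wt k) < e"
      using \<open>e > 0\<close> by (intro order_tendstoD) simp_all
    then obtain k where k: "2 * (1 / \<epsilon> - wt k) < e" by (auto simp: eventually_sequentially)
    obtain x where x: "x \<in> S" "below (\<xi> k) x" using b by blast
    have xV: "x \<in> V" using x assms by blast
    have "cd (Inl x) (Inr \<xi>) \<le> 2 * (1 / \<epsilon> - wt k)"
    proof (rule LIMSEQ_le_const2[OF cd_vertex_boundary[OF assms(1) xV]], intro exI allI impI)
      fix n assume "k \<le> n"
      then have "below (\<xi> k) (\<xi> n)"
        using boundary[OF assms(1)] by (simp add: boundary_below_iff[OF assms(1)])
      then have "k \<le> meet x (\<xi> n)"
        using below_le_meet[OF xV _ x(2), of "\<xi> n"] boundary[OF assms(1)] by simp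
      then have "wt k \<le> wt (meet x (\<xi> n))" by (rule wt_le)
      then show "d x (\<xi> n) \<le> 2 * (1 / \<epsilon> - wt k)"
        unfolding d_eq[OF xV boundary(1)[OF assms(1)]] mult_2
        by (intro add_mono diff_mono less_imp_le[OF wt_bound])
    qed
    then show ?thesis using k x cd_commute[of "Inl x" "Inr \<xi>"] by force
  qed
  then show "Inr \<xi> \<in> C.mtopology closure_of (Inl ` S)"
    unfolding C.metric_closure_of using assms by (force simp: C.in_mball)
qed

text \<open>
  The limit of a convergent path of vertices is the only boundary point in the closure of the
  path: a vertex of the path deep enough below another candidate \<open>\<xi>\<close> has a large index, hence also
  lies below \<open>\<omega> k\<close>.
\<close>

lemma closure_limit_iff:
  assumes V: "\<And>i. p i \<in> V" and w: "\<omega> \<in> bd" "converges_to p \<omega>"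
  shows "\<xi> \<in> bd \<and> Inr \<xi> \<in> C.mtopology closure_of (Inl ` range p) \<longleftrightarrow> \<xi> = \<omega>"
proof (intro iffI conjI)
  assume a: "\<xi> \<in> bd \<and> Inr \<xi> \<in> C.mtopology closure_of (Inl ` range p)"
  then have xi: "\<xi> \<in> bd" by simp
  have "range p \<subseteq> V" using V by blast
  from a boundary_point_in_closure_iff[OF xi this]
  have b: "\<exists>i. below (\<xi> k) (p i)" for k by auto
  show "\<xi> = \<omega>"
  proof
    fix k
    obtain N where N: "\<And>i. i \<ge> N \<Longrightarrow> below (\<omega> k) (p i)"
      using w(2) unfolding converges_to_def eventually_sequentially by blast
    \<comment> \<open>\<open>k'\<close> exceeds the levels of \<open>p 0, \<dots>, p N\<close>, so a vertex below \<open>\<xi> k'\<close> has an index above \<open>N\<close>\<close>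
    define k' where "k' = max k (Suc (Max ((\<lambda>i. lev (p i)) ` {..N})))"
    obtain i where i: "below (\<xi> k') (p i)" using b by blast
    have "\<not> i \<le> N"
    proof
      assume "i \<le> N"
      then have "lev (p i) \<le> Max ((\<lambda>i. lev (p i)) ` {..N})" by (intro Max_ge) auto
      then show False using i by (auto simp: boundary_below_iff[OF xi] k'_def)
    qed
    then have "below (\<omega> k) (p i)" using N by simp
    moreover have "below (\<xi> k) (p i)"
      using boundary_below_mono[OF xi V _ i] by (simp add: k'_def)
    ultimately show "\<xi> k = \<omega> k" by (simp add: boundary_below_iff xi w(1))
  qed
next
  assume eq: "\<xi> = \<omega>"
  then show "\<xi> \<in> bd" using w by simp
  have "\<exists>x\<in>range p. below (\<omega> k) x" for k
    using w(2) unfolding converges_to_def eventually_sequentially by blast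
  then show "Inr \<xi> \<in> C.mtopology closure_of (Inl ` range p)"
    using boundary_point_in_closure_iff[OF w(1), of "range p"] V eq by auto
qed

end

section \<open>The boundary extension of a rough quasiisometry\<close>

lemma filterlim_at_top_linear_minorant:
  fixes g :: "nat \<Rightarrow> real"
  assumes "c > 0" "\<And>i. c * real i - b \<le> g i"
  shows "filterlim g at_top sequentially"
proof (rule filterlim_at_top_mono)
  have "filterlim (\<lambda>i. - b + c * real i) at_top sequentially"
    by (intro filterlim_tendsto_add_at_top[OF tendsto_const]
        filterlim_tendsto_pos_mult_at_top[OF tendsto_const] filterlim_real_sequentially assms(1))
  then show "filterlim (\<lambda>i. c * real i - b) at_top sequentially" by simp
qed (simp add: assms(2))

locale tree_rough_quasiisometry =
  X: weighted_tree V E r \<epsilon> + Y: weighted_tree V' E' r' \<epsilon>'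
  for V :: "'a set" and E r and \<epsilon> :: real and V' :: "'b set" and E' r' and \<epsilon>' :: real +
  fixes F :: "'a \<Rightarrow> 'b" and L\<^sub>1 L\<^sub>2 \<Lambda> K :: real
  assumes F_in: "x \<in> V \<Longrightarrow> F x \<in> V'"
    and L1_pos: "L\<^sub>1 > 0" and L2_pos: "L\<^sub>2 > 0" and Lam_nonneg: "\<Lambda> \<ge> 0"
    and lower: "x \<in> V \<Longrightarrow> y \<in> V \<Longrightarrow> L\<^sub>1 * real (X.gd x y) - \<Lambda> \<le> real (Y.gd (F x) (F y))"
    and upper: "x \<in> V \<Longrightarrow> y \<in> V \<Longrightarrow> real (Y.gd (F x) (F y)) \<le> L\<^sub>2 * real (X.gd x y) + \<Lambda>"
    and coarsely_surj: "z \<in> V' \<Longrightarrow> \<exists>x\<in>V. real (Y.gd (F x) z) \<le> K"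
begin

abbreviation "f \<equiv> boundary_extension V' E' r' \<epsilon>' F"

text \<open>
  \<open>jump\<close> bounds the steps of an image ray, \<open>shift\<close> is the distance from the root of \<open>Y\<close> to the image
  of the root of \<open>X\<close>, and \<open>near\<close> is the bound obtained in \<open>image_branch_vertex\<close>: the fraction in it
  bounds the time between the branching of two rays and the passage of one image ray near the
  branching of the images, \<open>L\<^sub>2\<close> and \<open>\<Lambda>\<close> convert this time into a distance in \<open>Y\<close>, and \<open>jump + 1\<close>
  is the distance to the branching of the images at the passage.
\<close>

definition "jump = L\<^sub>2 + \<Lambda>"
definition "shift = real (Y.lev (F r))"
definition "near = L\<^sub>2 * ((2 * jump + 1 + shift + \<Lambda>) / L\<^sub>1) + \<Lambda> + jump + 1"

lemma consts_nonneg: "0 \<le> jump" "0 \<le> shift" "0 \<le> near"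
  using L1_pos L2_pos Lam_nonneg by (simp_all add: jump_def shift_def near_def)

lemma Y_triangle:
  "x \<in> V' \<Longrightarrow> y \<in> V' \<Longrightarrow> z \<in> V' \<Longrightarrow> real (Y.gd x z) \<le> real (Y.gd x y) + real (Y.gd y z)"
  using Y.gd_triangle[of x y z] by linarith

lemma Y_commute: "x \<in> V' \<Longrightarrow> y \<in> V' \<Longrightarrow> real (Y.gd x y) = real (Y.gd y x)"
  using Y.gd_commute by simp

lemma domain_close:
  assumes "x \<in> V" "y \<in> V" "z \<in> V'" "real (Y.gd (F x) z) \<le> A" "real (Y.gd (F y) z) \<le> B"
  shows "real (X.gd x y) \<le> (A + B + \<Lambda>) / L\<^sub>1"
proof -
  have "L\<^sub>1 * real (X.gd x y) \<le> A + B + \<Lambda>"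
    using lower[OF assms(1,2)] Y_triangle[of "F x" z "F y"] Y_commute[of z "F y"] F_in assms
    by simp
  then show ?thesis using L1_pos by (simp add: pos_le_divide_eq mult.commute)
qed

lemma image_ray_in: "\<zeta> \<in> X.bd \<Longrightarrow> F (\<zeta> i) \<in> V'"
  using F_in X.boundary(1) by blast

lemma image_ray_jump: "\<zeta> \<in> X.bd \<Longrightarrow> real (Y.gd (F (\<zeta> i)) (F (\<zeta> (Suc i)))) \<le> jump"
  using upper[of "\<zeta> i" "\<zeta> (Suc i)"] X.gd_along_boundary[of \<zeta> i "Suc i"] X.boundary(1)[of \<zeta>]
  by (simp add: jump_def)

lemma image_ray_start: "\<zeta> \<in> X.bd \<Longrightarrow> real (Y.lev (F (\<zeta> 0))) = shift"
  by (simp add: shift_def tree_boundary_def)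

lemma image_ray_dist:
  assumes "\<zeta> \<in> X.bd"
  shows "L\<^sub>1 * \<bar>real i - real j\<bar> - \<Lambda> \<le> real (Y.gd (F (\<zeta> i)) (F (\<zeta> j)))"
    and "real (Y.gd (F (\<zeta> i)) (F (\<zeta> j))) \<le> L\<^sub>2 * \<bar>real i - real j\<bar> + \<Lambda>"
  using lower[of "\<zeta> i" "\<zeta> j"] upper[of "\<zeta> i" "\<zeta> j"] X.boundary(1)[OF assms]
  by (simp_all add: X.gd_along_boundary[OF assms])

lemma image_ray_level:
  assumes "\<zeta> \<in> X.bd"
  shows "L\<^sub>1 * real i - \<Lambda> - shift \<le> real (Y.lev (F (\<zeta> i)))"
    and "real (Y.lev (F (\<zeta> i))) \<le> L\<^sub>2 * real i + \<Lambda> + shift"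
  using image_ray_dist[OF assms, of 0 i] image_ray_start[OF assms]
    Y_triangle[of "F (\<zeta> 0)" r' "F (\<zeta> i)"] Y_triangle[of r' "F (\<zeta> 0)" "F (\<zeta> i)"]
    Y_commute[of r' "F (\<zeta> 0)"] image_ray_in[OF assms] Y.root_in
  by simp_all

lemma extension_eqI:
  assumes "\<zeta> \<in> X.bd" "\<omega> \<in> Y.bd" "Y.converges_to (\<lambda>i. F (\<zeta> i)) \<omega>"
  shows "f \<zeta> = \<omega>"
proof -
  have "F ` range \<zeta> = range (\<lambda>i. F (\<zeta> i))" by auto
  then show ?thesis
    using Y.closure_limit_iff[OF image_ray_in[OF assms(1)] assms(2,3)]
    by (simp add: boundary_extension_def)
qed

lemma extension:
  assumes "\<zeta> \<in> X.bd"
  shows "f \<zeta> \<in> Y.bd" "Y.converges_to (\<lambda>i. F (\<zeta> i)) (f \<zeta>)"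
proof -
  have "filterlim (\<lambda>i. real (Y.lev (F (\<zeta> i)))) at_top sequentially"
    using image_ray_level(1)[OF assms]
    by (intro filterlim_at_top_linear_minorant[OF L1_pos, of "\<Lambda> + shift"]) (simp add: diff_diff_eq)
  then obtain \<omega> where "\<omega> \<in> Y.bd" "Y.converges_to (\<lambda>i. F (\<zeta> i)) \<omega>"
    using Y.bounded_jumps_converges[of "\<lambda>i. F (\<zeta> i)"] image_ray_in[OF assms]
      image_ray_jump[OF assms] by blast
  then show "f \<zeta> \<in> Y.bd" "Y.converges_to (\<lambda>i. F (\<zeta> i)) (f \<zeta>)"
    using extension_eqI[OF assms] by auto
qed

lemma extension_in: "\<zeta> \<in> X.bd \<Longrightarrow> f \<zeta> k \<in> V'"
  using Y.boundary(1) extension(1) by blast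

lemma image_ray_tracks:
  assumes "\<zeta> \<in> X.bd"
  shows "\<exists>i. real (Y.gd (F (\<zeta> i)) (f \<zeta> k)) \<le> jump + shift"
  using Y.converges_to_passes_near[of "\<lambda>i. F (\<zeta> i)" jump "f \<zeta>" k] image_ray_in[OF assms]
    image_ray_jump[OF assms] image_ray_start[OF assms] extension[OF assms] by simp

lemma image_ray_enters:
  assumes "\<zeta> \<in> X.bd" "\<not> Y.below (f \<zeta> k) (F (\<zeta> m))"
  shows "\<exists>i\<ge>m. real (Y.gd (F (\<zeta> i)) (f \<zeta> k)) \<le> jump"
  using Y.path_enters_subtree[of "\<lambda>i. F (\<zeta> i)" "f \<zeta> k" jump m] image_ray_in[OF assms(1)]
    image_ray_jump[OF assms(1)] extension[OF assms(1)] extension_in[OF assms(1)] assms(2)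
  by (simp add: Y.converges_to_def)

text \<open>
  If the images agreed, both image paths would pass near the vertex \<open>f \<zeta> k\<close> for arbitrarily large
  \<open>k\<close>. The lower bound for \<open>F\<close> would keep the corresponding vertices of \<open>\<zeta>\<close> and \<open>\<xi>\<close> close to each
  other, although they lie ever further beyond the branching.
\<close>

lemma extension_inj:
  assumes "\<zeta> \<in> X.bd" "\<xi> \<in> X.bd" "\<zeta> \<noteq> \<xi>"
  shows "f \<zeta> \<noteq> f \<xi>"
proof
  assume eq: "f \<zeta> = f \<xi>"
  define a where "a = real (X.branch_level \<zeta> \<xi>)"
  define M where "M = (2 * (jump + shift) + \<Lambda>) / L\<^sub>1"
  \<comment> \<open>the path reaches the vicinity of level \<open>k\<close> only at times \<open>s > a + M\<close>\<close>
  obtain k :: nat where k: "L\<^sub>2 * (a + M) + \<Lambda> + jump + 2 * shift < real k"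
    using reals_Archimedean2 by blast
  obtain s where s: "real (Y.gd (F (\<zeta> s)) (f \<zeta> k)) \<le> jump + shift"
    using image_ray_tracks[OF assms(1)] by blast
  obtain t where t: "real (Y.gd (F (\<xi> t)) (f \<zeta> k)) \<le> jump + shift"
    using image_ray_tracks[OF assms(2)] eq by metis
  have "real (X.gd (\<zeta> s) (\<xi> t)) \<le> M"
    using domain_close[OF X.boundary(1)[OF assms(1)] X.boundary(1)[OF assms(2)]
        extension_in[OF assms(1)] s t] by (simp add: M_def)
  then have "real s \<le> a + M"
    using X.gd_after_branching[OF assms, of s t] unfolding a_def by linarith
  then have "L\<^sub>2 * real s \<le> L\<^sub>2 * (a + M)" using L2_pos by simp
  moreover have "real k \<le> real (Y.lev (F (\<zeta> s))) + real (Y.gd (F (\<zeta> s)) (f \<zeta> k))"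
    using Y_triangle[OF Y.root_in image_ray_in extension_in, OF assms(1) assms(1), of k s]
      Y.boundary(2)[OF extension(1)[OF assms(1)], of k] by simp
  ultimately show False using k s image_ray_level(2)[OF assms(1), of s] by linarith
qed

text \<open>
  The path \<open>F (\<zeta> i)\<close> has not yet entered the branch of \<open>f \<zeta>\<close> beyond the separation from \<open>f \<xi>\<close> when
  \<open>i = X.branch_level \<zeta> \<xi>\<close>, so it passes the separating vertex at a later time \<open>n\<close>. The other path
  passes there as well, and the divergence of \<open>\<zeta>\<close> and \<open>\<xi>\<close> bounds \<open>n - X.branch_level \<zeta> \<xi>\<close>.
\<close>

lemma image_branch_vertex_aux:
  assumes "\<zeta> \<in> X.bd" "\<xi> \<in> X.bd" "\<zeta> \<noteq> \<xi>"
    and out: "\<not> Y.below (f \<zeta> (Suc (Y.branch_level (f \<zeta>) (f \<xi>)))) (F (\<zeta> (X.branch_level \<zeta> \<xi>)))"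
  shows "real (Y.gd (F (\<zeta> (X.branch_level \<zeta> \<xi>))) (f \<zeta> (Y.branch_level (f \<zeta>) (f \<xi>)))) \<le> near"
proof -
  define a where "a = X.branch_level \<zeta> \<xi>"
  define a' where "a' = Y.branch_level (f \<zeta>) (f \<xi>)"
  define M where "M = (2 * jump + 1 + shift + \<Lambda>) / L\<^sub>1"
  have v: "f \<zeta> a' = f \<xi> a'"
    using Y.branch_level_eq_iff[OF extension(1) extension(1) extension_inj, OF assms(1,2) assms(1-3)]
    by (simp add: a'_def)
  note V = X.boundary(1)[OF assms(1)] X.boundary(1)[OF assms(2)] image_ray_in[OF assms(1)]
    extension_in[OF assms(1)]
  obtain n where n: "a \<le> n" "real (Y.gd (F (\<zeta> n)) (f \<zeta> (Suc a'))) \<le> jump"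
    using image_ray_enters[OF assms(1) out] by (auto simp: a_def a'_def)
  have n': "real (Y.gd (F (\<zeta> n)) (f \<zeta> a')) \<le> jump + 1"
    using Y_triangle[of "F (\<zeta> n)" "f \<zeta> (Suc a')" "f \<zeta> a'"] V n(2)
      Y.gd_along_boundary[OF extension(1)[OF assms(1)], of "Suc a'" a'] by simp
  obtain t where t: "real (Y.gd (F (\<xi> t)) (f \<zeta> a')) \<le> jump + shift"
    using image_ray_tracks[OF assms(2)] v by metis
  have "real (X.gd (\<zeta> n) (\<xi> t)) \<le> M"
    using domain_close[OF V(1,2) V(4) n' t] by (simp add: M_def algebra_simps)
  then have "real n - real a \<le> M"
    using X.gd_after_branching[OF assms(1-3), of n t] unfolding a_def by linarith
  then have "L\<^sub>2 * \<bar>real a - real n\<bar> \<le> L\<^sub>2 * M" using n(1) L2_pos by simp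
  then have "real (Y.gd (F (\<zeta> a)) (f \<zeta> a')) \<le> L\<^sub>2 * M + \<Lambda> + jump + 1"
    using image_ray_dist(2)[OF assms(1), of a n] n' Y_triangle[OF V(3) V(3) V(4), of a a' n]
    by linarith
  then show ?thesis by (simp add: near_def a_def a'_def M_def)
qed

text \<open>
  The two branches beyond the separating vertex of \<open>f \<zeta>\<close> and \<open>f \<xi>\<close> are disjoint subtrees, so the
  preceding lemma applies to \<open>(\<zeta>, \<xi>)\<close> or to \<open>(\<xi>, \<zeta>)\<close>.
\<close>

lemma image_branch_vertex:
  assumes "\<zeta> \<in> X.bd" "\<xi> \<in> X.bd" "\<zeta> \<noteq> \<xi>"
  shows "real (Y.gd (F (\<zeta> (X.branch_level \<zeta> \<xi>))) (f \<zeta> (Y.branch_level (f \<zeta>) (f \<xi>)))) \<le> near"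
proof (cases "Y.below (f \<zeta> (Suc (Y.branch_level (f \<zeta>) (f \<xi>)))) (F (\<zeta> (X.branch_level \<zeta> \<xi>)))")
  case False
  then show ?thesis by (rule image_branch_vertex_aux[OF assms])
next
  case True
  define a where "a = X.branch_level \<zeta> \<xi>"
  define a' where "a' = Y.branch_level (f \<zeta>) (f \<xi>)"
  have com: "X.branch_level \<xi> \<zeta> = a" "Y.branch_level (f \<xi>) (f \<zeta>) = a'"
    by (simp_all add: a_def a'_def X.branch_level_commute Y.branch_level_commute)
  note iff = Y.branch_level_eq_iff[OF extension(1) extension(1) extension_inj,
      OF assms(1,2) assms(1-3), folded a'_def]
  have eq: "\<zeta> a = \<xi> a" using X.branch_level_eq_iff[OF assms] by (simp add: a_def)
  have "\<not> Y.below (f \<xi> (Suc a')) (F (\<zeta> a))"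
    using True iff[of "Suc a'"]
      Y.boundary_below_iff[OF extension(1)[OF assms(1)]]
      Y.boundary_below_iff[OF extension(1)[OF assms(2)]]
    by (auto simp: a_def a'_def)
  then show ?thesis
    using image_branch_vertex_aux[OF assms(2,1) assms(3)[symmetric]] eq iff[of a']
    unfolding com by (simp flip: a_def a'_def)
qed

text \<open>
  The separation vertex of \<open>f \<zeta>\<close> and \<open>f \<xi>\<close> is near the image of that of \<open>\<zeta>\<close> and \<open>\<xi>\<close>, and the
  level of this image is controlled by the bounds for \<open>F\<close> along \<open>\<zeta>\<close>. In terms of visual distances, the two inequalities say
  that \<open>f\<close> and its inverse are Hoelder continuous.
\<close>

lemma branch_level_bounds:
  assumes "\<zeta> \<in> X.bd" "\<xi> \<in> X.bd" "\<zeta> \<noteq> \<xi>"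
  shows "L\<^sub>1 * real (X.branch_level \<zeta> \<xi>) - (\<Lambda> + shift + near)
           \<le> real (Y.branch_level (f \<zeta>) (f \<xi>))"
    and "real (Y.branch_level (f \<zeta>) (f \<xi>))
           \<le> L\<^sub>2 * real (X.branch_level \<zeta> \<xi>) + (\<Lambda> + shift + near)"
proof -
  define a where "a = X.branch_level \<zeta> \<xi>"
  define a' where "a' = Y.branch_level (f \<zeta>) (f \<xi>)"
  have V: "F (\<zeta> a) \<in> V'" "f \<zeta> a' \<in> V'" using image_ray_in extension_in assms by blast+
  have "real (Y.gd (F (\<zeta> a)) (f \<zeta> a')) \<le> near"
    using image_branch_vertex[OF assms] by (simp add: a_def a'_def)
  then have "\<bar>real a' - real (Y.lev (F (\<zeta> a)))\<bar> \<le> near"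
    using Y_triangle[OF Y.root_in V] Y_triangle[OF Y.root_in V(2,1)] Y_commute[OF V]
      Y.boundary(2)[OF extension(1)[OF assms(1)], of a'] by simp
  then show "L\<^sub>1 * real (X.branch_level \<zeta> \<xi>) - (\<Lambda> + shift + near)
           \<le> real (Y.branch_level (f \<zeta>) (f \<xi>))"
    "real (Y.branch_level (f \<zeta>) (f \<xi>))
           \<le> L\<^sub>2 * real (X.branch_level \<zeta> \<xi>) + (\<Lambda> + shift + near)"
    using image_ray_level[OF assms(1), of a] unfolding a_def a'_def by linarith+
qed

text \<open>
  The distance between the vertices at which \<open>\<zeta>\<close> separates from \<open>\<xi>\<close> and from \<open>\<tau>\<close> is the difference of
  their levels, and likewise for \<open>f \<zeta>\<close>. The map \<open>F\<close> takes the former pair to within \<open>near\<close> of the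
  latter.
\<close>

lemma branch_level_gap:
  assumes "\<zeta> \<in> X.bd" "\<xi> \<in> X.bd" "\<tau> \<in> X.bd" "\<zeta> \<noteq> \<xi>" "\<zeta> \<noteq> \<tau>"
  defines "g \<equiv> \<bar>real (X.branch_level \<zeta> \<xi>) - real (X.branch_level \<zeta> \<tau>)\<bar>"
    and "g' \<equiv> \<bar>real (Y.branch_level (f \<zeta>) (f \<xi>)) - real (Y.branch_level (f \<zeta>) (f \<tau>))\<bar>"
  shows "L\<^sub>1 * g - (\<Lambda> + 2 * near) \<le> g'" "g' \<le> L\<^sub>2 * g + (\<Lambda> + 2 * near)"
proof -
  define a where "a = X.branch_level \<zeta> \<xi>"
  define b where "b = X.branch_level \<zeta> \<tau>"
  define a' where "a' = Y.branch_level (f \<zeta>) (f \<xi>)"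
  define b' where "b' = Y.branch_level (f \<zeta>) (f \<tau>)"
  have V: "F (\<zeta> i) \<in> V'" "f \<zeta> i \<in> V'" for i using image_ray_in extension_in assms by blast+
  have na: "real (Y.gd (F (\<zeta> a)) (f \<zeta> a')) \<le> near"
    using image_branch_vertex[OF assms(1,2,4)] by (simp add: a_def a'_def)
  have nb: "real (Y.gd (F (\<zeta> b)) (f \<zeta> b')) \<le> near"
    using image_branch_vertex[OF assms(1,3,5)] by (simp add: b_def b'_def)
  have "real (Y.gd (F (\<zeta> a)) (F (\<zeta> b))) \<le> \<bar>real a' - real b'\<bar> + 2 * near"
    using Y_triangle[OF V(1) V(2) V(1), of a b a'] Y_triangle[OF V(2) V(2) V(1), of a' b b']
      Y_commute[OF V(2) V(1), of b' b] na nb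
      Y.gd_along_boundary[OF extension(1)[OF assms(1)], of a' b'] by linarith
  moreover have "\<bar>real a' - real b'\<bar> \<le> real (Y.gd (F (\<zeta> a)) (F (\<zeta> b))) + 2 * near"
    using Y_triangle[OF V(2) V(1) V(2), of a' b' a] Y_triangle[OF V(1) V(1) V(2), of a b' b]
      Y_commute[OF V(2) V(1), of a' a] na nb
      Y.gd_along_boundary[OF extension(1)[OF assms(1)], of a' b'] by linarith
  ultimately show "L\<^sub>1 * g - (\<Lambda> + 2 * near) \<le> g'" "g' \<le> L\<^sub>2 * g + (\<Lambda> + 2 * near)"
    using image_ray_dist[OF assms(1), of a b] unfolding g_def g'_def a_def a'_def b_def b'_def
    by linarith+
qed

text \<open>
  Suppose that \<open>\<zeta>\<close> separates from \<open>\<tau>\<close> at level \<open>b\<close>, long before it separates from \<open>\<xi>\<close> at level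
  \<open>a\<close>, but that the image rays separate in the opposite order. The path \<open>F (\<zeta> i)\<close> is near the
  vertex where \<open>f \<zeta>\<close> and \<open>f \<tau>\<close> separate at time \<open>b\<close>, but at time \<open>a\<close> near a vertex of \<open>f \<zeta>\<close> closer to
  the root. On its way from there to \<open>f \<zeta>\<close> it is close to the former vertex at some time \<open>c \<ge> a\<close>
  again. The lower bound for \<open>F\<close> limits \<open>c - b\<close>, and hence \<open>a - b\<close>.
\<close>

lemma branch_order_almost_preserved:
  assumes "\<zeta> \<in> X.bd" "\<xi> \<in> X.bd" "\<tau> \<in> X.bd" "\<zeta> \<noteq> \<xi>" "\<zeta> \<noteq> \<tau>"
    and less: "Y.branch_level (f \<zeta>) (f \<xi>) < Y.branch_level (f \<zeta>) (f \<tau>)"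
  shows "real (X.branch_level \<zeta> \<xi>) - real (X.branch_level \<zeta> \<tau>) \<le> (2 * near + jump + \<Lambda>) / L\<^sub>1"
proof -
  define a where "a = X.branch_level \<zeta> \<xi>"
  define b where "b = X.branch_level \<zeta> \<tau>"
  define a' where "a' = Y.branch_level (f \<zeta>) (f \<xi>)"
  define b' where "b' = Y.branch_level (f \<zeta>) (f \<tau>)"
  have V: "F (\<zeta> i) \<in> V'" "f \<zeta> i \<in> V'" for i using image_ray_in extension_in assms by blast+
  have na: "real (Y.gd (F (\<zeta> a)) (f \<zeta> a')) \<le> near"
    using image_branch_vertex[OF assms(1,2,4)] by (simp add: a_def a'_def)
  have nb: "real (Y.gd (F (\<zeta> b)) (f \<zeta> b')) \<le> near"
    using image_branch_vertex[OF assms(1,3,5)] by (simp add: b_def b'_def)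
  have "\<exists>c\<ge>a. real (Y.gd (F (\<zeta> c)) (f \<zeta> b')) \<le> near + jump"
  proof (cases "Y.below (f \<zeta> b') (F (\<zeta> a))")
    case True
    note w = Y.boundary[OF extension(1)[OF assms(1)]]
    have ab: "a' < b'" using less by (simp add: a'_def b'_def)
    have "Y.below (f \<zeta> a') (F (\<zeta> a))"
      by (rule Y.boundary_below_mono[OF extension(1)[OF assms(1)] V(1) _ True]) (use ab in simp)
    then have "Y.gd (f \<zeta> b') (F (\<zeta> a)) \<le> Y.gd (f \<zeta> a') (F (\<zeta> a))"
      using Y.gd_below[OF V(1) V(2)] True w ab by simp
    then have "real (Y.gd (F (\<zeta> a)) (f \<zeta> b')) \<le> near + jump"
      using na Y_commute[OF V, of a a'] Y_commute[OF V, of a b'] consts_nonneg(1) by linarith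
    then show ?thesis by blast
  next
    case False
    then show ?thesis using image_ray_enters[OF assms(1)] consts_nonneg(3) by force
  qed
  then obtain c where c: "c \<ge> a" "real (Y.gd (F (\<zeta> c)) (f \<zeta> b')) \<le> near + jump" by blast
  have "real (X.gd (\<zeta> c) (\<zeta> b)) \<le> (near + jump + near + \<Lambda>) / L\<^sub>1"
    by (rule domain_close[OF _ _ V(2) c(2) nb]) (use X.boundary assms in blast)+
  then show ?thesis
    using c(1) X.gd_along_boundary[OF assms(1), of c b] by (simp add: a_def b_def algebra_simps)
qed

text \<open>
  If the order of the branch levels is preserved, this is \<open>branch_level_gap\<close> with the right sign.
  If it is reversed, both differences are bounded and are absorbed in the constant.
\<close>

lemma branch_level_control:
  obtains C where "C \<ge> 0"
    and "\<And>\<zeta> \<xi> \<tau>. \<zeta> \<in> X.bd \<Longrightarrow> \<xi> \<in> X.bd \<Longrightarrow> \<tau> \<in> X.bd \<Longrightarrow> \<zeta> \<noteq> \<xi> \<Longrightarrow> \<zeta> \<noteq> \<tau> \<Longrightarrow>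
      real (Y.branch_level (f \<zeta>) (f \<tau>)) - real (Y.branch_level (f \<zeta>) (f \<xi>)) \<le>
      (if X.branch_level \<zeta> \<tau> \<le> X.branch_level \<zeta> \<xi> then L\<^sub>1 else L\<^sub>2) *
        (real (X.branch_level \<zeta> \<tau>) - real (X.branch_level \<zeta> \<xi>)) + C"
proof
  define M where "M = (2 * near + jump + \<Lambda>) / L\<^sub>1"
  define C where "C = (L\<^sub>1 + L\<^sub>2) * M + \<Lambda> + 2 * near"
  have M: "0 \<le> M" using consts_nonneg Lam_nonneg L1_pos by (simp add: M_def)
  then have LM: "0 \<le> (L\<^sub>1 + L\<^sub>2) * M" using L1_pos L2_pos by simp
  then show "0 \<le> C" using consts_nonneg Lam_nonneg by (simp add: C_def)
  fix \<zeta> \<xi> \<tau> assume A: "\<zeta> \<in> X.bd" "\<xi> \<in> X.bd" "\<tau> \<in> X.bd" "\<zeta> \<noteq> \<xi>" "\<zeta> \<noteq> \<tau>"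
  define a where "a = X.branch_level \<zeta> \<xi>"
  define b where "b = X.branch_level \<zeta> \<tau>"
  define a' where "a' = Y.branch_level (f \<zeta>) (f \<xi>)"
  define b' where "b' = Y.branch_level (f \<zeta>) (f \<tau>)"
  note gap = branch_level_gap[OF A, folded a_def b_def a'_def b'_def]
  have "real b' - real a' \<le> (if b \<le> a then L\<^sub>1 else L\<^sub>2) * (real b - real a) + C"
  proof (cases "b \<le> a")
    case False
    then show ?thesis using gap(2) LM by (simp add: C_def)
  next
    case True
    then have g: "\<bar>real a - real b\<bar> = real a - real b" by simp
    show ?thesis
    proof (cases "a' < b'")
      case False
      then have "L\<^sub>1 * (real a - real b) - (\<Lambda> + 2 * near) \<le> real a' - real b'"
        using gap(1) unfolding g by simp
      then show ?thesis using True LM by (simp add: C_def algebra_simps)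
    next
      case less: True
      then have le: "real a - real b \<le> M"
        using branch_order_almost_preserved[OF A] by (simp add: a_def b_def a'_def b'_def M_def)
      have "(L\<^sub>1 + L\<^sub>2) * (real a - real b) \<le> (L\<^sub>1 + L\<^sub>2) * M"
        using le L1_pos L2_pos by (intro mult_left_mono) simp_all
      moreover have "real b' - real a' \<le> L\<^sub>2 * (real a - real b) + (\<Lambda> + 2 * near)"
        using gap(2) less unfolding g by simp
      ultimately show ?thesis using True by (simp add: C_def algebra_simps)
    qed
  qed
  then show "real (Y.branch_level (f \<zeta>) (f \<tau>)) - real (Y.branch_level (f \<zeta>) (f \<xi>)) \<le>
      (if X.branch_level \<zeta> \<tau> \<le> X.branch_level \<zeta> \<xi> then L\<^sub>1 else L\<^sub>2) *
        (real (X.branch_level \<zeta> \<tau>) - real (X.branch_level \<zeta> \<xi>)) + C"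
    by (simp add: a_def b_def a'_def b'_def)
qed

text \<open>
  Choose \<open>u k\<close> with \<open>F (u k)\<close> near \<open>\<omega> k\<close>. By the lower bound for \<open>F\<close> the jumps of \<open>u\<close> are bounded,
  and by the upper bound \<open>u\<close> leaves every ball, so \<open>u\<close> converges to a boundary point \<open>\<zeta>\<close>. Since
  \<open>u\<close> passes near every \<open>\<zeta> i\<close>, the image path of \<open>\<zeta>\<close> stays near \<open>\<omega>\<close> and converges to it.
\<close>

lemma extension_surj:
  assumes w: "\<omega> \<in> Y.bd"
  shows "\<exists>\<zeta>\<in>X.bd. f \<zeta> = \<omega>"
proof -
  have wV: "\<omega> k \<in> V'" for k by (rule Y.boundary(1)[OF w])
  have "\<exists>x\<in>V. real (Y.gd (F x) (\<omega> k)) \<le> K" for k by (rule coarsely_surj[OF wV])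
  then obtain u where u: "\<And>k. u k \<in> V" "\<And>k. real (Y.gd (F (u k)) (\<omega> k)) \<le> K" by metis
  define J where "J = (2 * K + 1 + \<Lambda>) / L\<^sub>1"
  have jump: "real (X.gd (u k) (u (Suc k))) \<le> J" for k
  proof -
    have "real (Y.gd (F (u (Suc k))) (\<omega> k)) \<le> K + 1"
      using Y_triangle[OF F_in[OF u(1)] wV wV, of "Suc k" k "Suc k"] u(2)[of "Suc k"]
        Y.gd_along_boundary[OF w, of "Suc k" k] by simp
    from domain_close[OF u(1) u(1) wV u(2) this] show ?thesis
      by (simp add: J_def algebra_simps)
  qed
  have "filterlim (\<lambda>k. real (X.lev (u k))) at_top sequentially"
  proof (rule filterlim_at_top_linear_minorant)
    fix k
    have "real k \<le> real (Y.lev (F r)) + real (Y.gd (F r) (F (u k))) + real (Y.gd (F (u k)) (\<omega> k))"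
      using Y_triangle[OF Y.root_in F_in[OF X.root_in] wV, of k] Y.boundary(2)[OF w, of k]
        Y_triangle[OF F_in[OF X.root_in] F_in[OF u(1)] wV, of k k] by simp
    then have "real k - (shift + \<Lambda> + K) \<le> L\<^sub>2 * real (X.lev (u k))"
      using upper[OF X.root_in u(1), of k] u(2)[of k] by (simp add: shift_def)
    then show "1 / L\<^sub>2 * real k - (shift + \<Lambda> + K) / L\<^sub>2 \<le> real (X.lev (u k))"
      using L2_pos by (simp add: field_simps)
  qed (use L2_pos in simp)
  then obtain \<zeta> where z: "\<zeta> \<in> X.bd" "X.converges_to u \<zeta>"
    using X.bounded_jumps_converges[where p = u, OF u(1) jump] by blast
  define R where "R = L\<^sub>2 * (J + real (X.lev (u 0))) + \<Lambda> + K"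
  have close: "\<exists>k. real (Y.gd (F (\<zeta> i)) (\<omega> k)) \<le> R" for i
  proof -
    obtain k where k: "real (X.gd (u k) (\<zeta> i)) \<le> J + real (X.lev (u 0))"
      using X.converges_to_passes_near[where p = u, OF u(1) jump z] by blast
    have zi: "\<zeta> i \<in> V" by (rule X.boundary(1)[OF z(1)])
    have "L\<^sub>2 * real (X.gd (u k) (\<zeta> i)) \<le> L\<^sub>2 * (J + real (X.lev (u 0)))"
      using k L2_pos by simp
    then have "real (Y.gd (F (\<zeta> i)) (\<omega> k)) \<le> R"
      using upper[OF u(1) zi, of k] u(2)[of k] Y_commute[OF F_in[OF u(1)] F_in[OF zi], of k]
        Y_triangle[OF F_in[OF zi] F_in[OF u(1)] wV, of k k] unfolding R_def by linarith
    then show ?thesis by blast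
  qed
  have "Y.converges_to (\<lambda>i. F (\<zeta> i)) \<omega>"
    unfolding Y.converges_to_def
  proof
    fix j
    have "filterlim (\<lambda>i. real (Y.lev (F (\<zeta> i)))) at_top sequentially"
      using image_ray_level(1)[OF z(1)]
      by (intro filterlim_at_top_linear_minorant[OF L1_pos, of "\<Lambda> + shift"]) (simp add: diff_diff_eq)
    then have "\<forall>\<^sub>F i in sequentially. real j + R < real (Y.lev (F (\<zeta> i)))"
      by (simp add: filterlim_at_top_dense)
    then show "\<forall>\<^sub>F i in sequentially. Y.below (\<omega> j) (F (\<zeta> i))"
    proof eventually_elim
      case (elim i)
      obtain k where k: "real (Y.gd (F (\<zeta> i)) (\<omega> k)) \<le> R" using close by blast
      have FV: "F (\<zeta> i) \<in> V'" by (rule image_ray_in[OF z(1)])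
      have "j \<le> Y.meet (F (\<zeta> i)) (\<omega> k)"
        using Y.gd_meet[OF FV wV, of k] Y.meet_le(2)[OF FV wV, of k] k elim by linarith
      then show ?case
        unfolding Y.le_meet[OF FV wV] Y.boundary_below_iff[OF w]
        using Y.boundary(2)[OF w] Y.boundary(4)[OF w] by auto
    qed
  qed
  then show ?thesis using extension_eqI[OF z(1) w] z(1) by blast
qed

end

section \<open>Hoelder maps, power functions and the quasisymmetry estimate\<close>

lemma continuous_map_Hoelder:
  assumes M: "Metric_space M d" "Metric_space M' d'" and im: "f \<in> M \<rightarrow> M'" and "\<alpha> > 0"
    and le: "\<And>x y. x \<in> M \<Longrightarrow> y \<in> M \<Longrightarrow> d' (f x) (f y) \<le> B * d x y powr \<alpha>"
  shows "continuous_map (Metric_space.mtopology M d) (Metric_space.mtopology M' d') f"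
proof -
  interpret M: Metric_space M d by (rule M(1))
  interpret M': Metric_space M' d' by (rule M(2))
  have "\<exists>\<delta>>0. \<forall>x. x \<in> M \<and> d a x < \<delta> \<longrightarrow> d' (f a) (f x) < e" if a: "a \<in> M" and e: "e > 0" for a e
  proof -
    \<comment> \<open>a positive Hoelder constant, so that \<open>\<delta>\<close> is well defined\<close>
    define B' where "B' = max B 1"
    have B': "B' > 0" "B \<le> B'" by (auto simp: B'_def)
    define \<delta> where "\<delta> = (e / B') powr (1 / \<alpha>)"
    have "d' (f a) (f x) < e" if x: "x \<in> M" "d a x < \<delta>" for x
    proof -
      have "d a x powr \<alpha> < \<delta> powr \<alpha>"
        using x(2) \<open>\<alpha> > 0\<close> by (intro powr_less_mono2) simp_all
      also have "\<delta> powr \<alpha> = e / B'" using \<open>\<alpha> > 0\<close> e B' by (simp add: \<delta>_def powr_powr)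
      finally have "B' * d a x powr \<alpha> < e" using B' by (simp add: field_simps)
      moreover have "B * d a x powr \<alpha> \<le> B' * d a x powr \<alpha>" using B' by (intro mult_right_mono) simp_all
      ultimately show ?thesis using le[OF a x(1)] by linarith
    qed
    moreover have "\<delta> > 0" using e B' by (simp add: \<delta>_def)
    ultimately show ?thesis by blast
  qed
  then show ?thesis using im by (simp add: M.metric_continuous_map[OF M(2)] image_subset_iff Pi_iff)
qed

text \<open>
  The two powers agree at \<open>1\<close>, and the inverse has the same form with the inverse exponents. At
  \<open>0\<close> the value is \<open>0\<close>.
\<close>

lemma homeomorphic_map_two_powers:
  assumes "A > 0" "\<alpha> > 0" "\<beta> > 0"
  shows "homeomorphic_map (top_of_set {0::real..}) (top_of_set {0..})
           (\<lambda>t. if t \<le> 1 then A * t powr \<alpha> else A * t powr \<beta>)"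
proof -
  define p where "p \<alpha> \<beta> = (\<lambda>t::real. if t \<le> 1 then t powr \<alpha> else t powr \<beta>)" for \<alpha> \<beta> :: real
  have cont: "continuous_on {0..} (p \<alpha> \<beta>)" if "\<alpha> > 0" "\<beta> > 0" for \<alpha> \<beta>
  proof -
    have "{0::real..} = {0..1} \<union> {1..}" by auto
    moreover have "continuous_on ({0..1} \<union> {1..}) (p \<alpha> \<beta>)"
      unfolding p_def using that
      by (intro continuous_on_cases continuous_on_powr' continuous_intros) auto
    ultimately show ?thesis by simp
  qed
  have nonneg: "p \<alpha> \<beta> t \<ge> 0" for \<alpha> \<beta> t by (simp add: p_def)
  have inv: "p (1 / \<alpha>) (1 / \<beta>) (p \<alpha> \<beta> t) = t" if "\<alpha> > 0" "\<beta> > 0" "t \<ge> 0" for \<alpha> \<beta> t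
  proof (cases "t \<le> 1")
    case True
    then have "t powr \<alpha> \<le> 1" using that powr_mono2[of \<alpha> t 1] by simp
    then show ?thesis using True that by (simp add: p_def powr_powr)
  next
    case False
    then have "1 powr \<beta> < t powr \<beta>" using that by (intro powr_less_mono2) simp_all
    then have "\<not> t powr \<beta> \<le> 1" by simp
    then show ?thesis using False that by (simp add: p_def powr_powr)
  qed
  have "homeomorphic_maps (top_of_set {0..}) (top_of_set {0..})
      (\<lambda>t. A * p \<alpha> \<beta> t) (\<lambda>s. p (1 / \<alpha>) (1 / \<beta>) (s / A))"
    unfolding homeomorphic_maps_def
  proof (intro conjI)
    show "continuous_map (top_of_set {0..}) (top_of_set {0..}) (\<lambda>t. A * p \<alpha> \<beta> t)"
      using assms nonneg by (auto intro!: continuous_intros cont)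
    have "continuous_on {0..} (p (1 / \<alpha>) (1 / \<beta>) \<circ> (\<lambda>s. s / A))"
      using assms by (intro continuous_on_compose continuous_intros continuous_on_subset[OF cont]) auto
    then show "continuous_map (top_of_set {0..}) (top_of_set {0..}) (\<lambda>s. p (1 / \<alpha>) (1 / \<beta>) (s / A))"
      using nonneg by (auto simp: comp_def)
    show "\<forall>t\<in>topspace (top_of_set {0..}). p (1 / \<alpha>) (1 / \<beta>) (A * p \<alpha> \<beta> t / A) = t"
      using inv assms by simp
    show "\<forall>s\<in>topspace (top_of_set {0..}). A * p \<alpha> \<beta> (p (1 / \<alpha>) (1 / \<beta>) (s / A)) = s"
      using inv[of "1 / \<alpha>" "1 / \<beta>"] assms by simp
  qed
  then have "homeomorphic_map (top_of_set {0..}) (top_of_set {0..}) (\<lambda>t. A * p \<alpha> \<beta> t)"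
    by (rule homeomorphic_maps_imp_map)
  moreover have "(\<lambda>t. A * p \<alpha> \<beta> t) = (\<lambda>t. if t \<le> 1 then A * t powr \<alpha> else A * t powr \<beta>)"
    by (simp add: p_def fun_eq_iff)
  ultimately show ?thesis by simp
qed

text \<open>
  A linear lower bound for branch levels is a Hoelder bound for visual distances.
\<close>

lemma exp_level_Hoelder:
  fixes \<epsilon> \<epsilon>' a a' c C :: real
  assumes "\<epsilon> > 0" "\<epsilon>' > 0" "c * a - C \<le> a'"
  defines "\<alpha> \<equiv> c * \<epsilon>' / \<epsilon>"
  shows "2 / \<epsilon>' * exp (- \<epsilon>' * a') \<le>
    2 / \<epsilon>' * exp (\<epsilon>' * C) / (2 / \<epsilon>) powr \<alpha> * (2 / \<epsilon> * exp (- \<epsilon> * a)) powr \<alpha>"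
proof -
  have "\<epsilon>' * (c * a - C) \<le> \<epsilon>' * a'" using assms by (intro mult_left_mono) simp_all
  then have "exp (- \<epsilon>' * a') \<le> exp (\<epsilon>' * C + - \<epsilon> * a * \<alpha>)"
    using assms(1) by (simp add: \<alpha>_def algebra_simps)
  also have "\<dots> = exp (\<epsilon>' * C) * exp (- \<epsilon> * a) powr \<alpha>"
    unfolding exp_add by (simp add: exp_powr_real)
  finally have "2 / \<epsilon>' * exp (- \<epsilon>' * a') \<le> 2 / \<epsilon>' * (exp (\<epsilon>' * C) * exp (- \<epsilon> * a) powr \<alpha>)"
    using assms by (intro mult_left_mono) simp_all
  also have "\<dots> = 2 / \<epsilon>' * exp (\<epsilon>' * C) / (2 / \<epsilon>) powr \<alpha> * (2 / \<epsilon> * exp (- \<epsilon> * a)) powr \<alpha>"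
    unfolding powr_mult using assms(1) by simp
  finally show ?thesis .
qed

context tree_rough_quasiisometry
begin

lemma extension_Hoelder:
  obtains B where "\<And>\<zeta> \<xi>. \<zeta> \<in> X.bd \<Longrightarrow> \<xi> \<in> X.bd \<Longrightarrow>
    visual_dist \<epsilon>' (f \<zeta>) (f \<xi>) \<le> B * visual_dist \<epsilon> \<zeta> \<xi> powr (L\<^sub>1 * \<epsilon>' / \<epsilon>)"
proof
  fix \<zeta> \<xi> assume A: "\<zeta> \<in> X.bd" "\<xi> \<in> X.bd"
  show "visual_dist \<epsilon>' (f \<zeta>) (f \<xi>) \<le>
      (2 / \<epsilon>' * exp (\<epsilon>' * (\<Lambda> + shift + near)) / (2 / \<epsilon>) powr (L\<^sub>1 * \<epsilon>' / \<epsilon>)) *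
        visual_dist \<epsilon> \<zeta> \<xi> powr (L\<^sub>1 * \<epsilon>' / \<epsilon>)"
  proof (cases "\<zeta> = \<xi>")
    case True
    then show ?thesis by (simp add: visual_dist_def)
  next
    case False
    show ?thesis
      unfolding X.visual_dist_branch_level[OF False] Y.visual_dist_branch_level[OF extension_inj[OF A False]]
      by (rule exp_level_Hoelder[OF X.eps_pos Y.eps_pos branch_level_bounds(1)[OF A False]])
  qed
qed

lemma inverse_Hoelder:
  obtains B where "\<And>\<zeta> \<xi>. \<zeta> \<in> X.bd \<Longrightarrow> \<xi> \<in> X.bd \<Longrightarrow>
    visual_dist \<epsilon> \<zeta> \<xi> \<le> B * visual_dist \<epsilon>' (f \<zeta>) (f \<xi>) powr (1 / L\<^sub>2 * \<epsilon> / \<epsilon>')"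
proof
  fix \<zeta> \<xi> assume A: "\<zeta> \<in> X.bd" "\<xi> \<in> X.bd"
  show "visual_dist \<epsilon> \<zeta> \<xi> \<le>
      (2 / \<epsilon> * exp (\<epsilon> * ((\<Lambda> + shift + near) / L\<^sub>2)) / (2 / \<epsilon>') powr (1 / L\<^sub>2 * \<epsilon> / \<epsilon>')) *
        visual_dist \<epsilon>' (f \<zeta>) (f \<xi>) powr (1 / L\<^sub>2 * \<epsilon> / \<epsilon>')"
  proof (cases "\<zeta> = \<xi>")
    case True
    then show ?thesis by (simp add: visual_dist_def)
  next
    case False
    have "1 / L\<^sub>2 * real (Y.branch_level (f \<zeta>) (f \<xi>)) - (\<Lambda> + shift + near) / L\<^sub>2
        \<le> real (X.branch_level \<zeta> \<xi>)"
      using branch_level_bounds(2)[OF A False] L2_pos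
      by (simp add: diff_divide_distrib[symmetric] pos_divide_le_eq mult.commute)
    then show ?thesis
      unfolding X.visual_dist_branch_level[OF False] Y.visual_dist_branch_level[OF extension_inj[OF A False]]
      by (rule exp_level_Hoelder[OF Y.eps_pos X.eps_pos])
  qed
qed

lemma extension_homeomorphic:
  "homeomorphic_map X.B.mtopology Y.B.mtopology f"
proof -
  define g where "g = inv_into X.bd f"
  have inj: "inj_on f X.bd" using extension_inj by (auto simp: inj_on_def)
  have im: "f ` X.bd = Y.bd" using extension(1) extension_surj by blast
  have gf: "g (f \<zeta>) = \<zeta>" if "\<zeta> \<in> X.bd" for \<zeta>
    using inv_into_f_f[OF inj that] by (simp add: g_def)
  have fg: "f (g \<omega>) = \<omega>" "g \<omega> \<in> X.bd" if "\<omega> \<in> Y.bd" for \<omega>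
    using that im f_inv_into_f[of \<omega> f X.bd] inv_into_into[of \<omega> f X.bd] by (simp_all add: g_def)
  obtain B where B: "\<And>\<zeta> \<xi>. \<zeta> \<in> X.bd \<Longrightarrow> \<xi> \<in> X.bd \<Longrightarrow>
      visual_dist \<epsilon>' (f \<zeta>) (f \<xi>) \<le> B * visual_dist \<epsilon> \<zeta> \<xi> powr (L\<^sub>1 * \<epsilon>' / \<epsilon>)"
    using extension_Hoelder by blast
  obtain B' where B': "\<And>\<zeta> \<xi>. \<zeta> \<in> X.bd \<Longrightarrow> \<xi> \<in> X.bd \<Longrightarrow>
      visual_dist \<epsilon> \<zeta> \<xi> \<le> B' * visual_dist \<epsilon>' (f \<zeta>) (f \<xi>) powr (1 / L\<^sub>2 * \<epsilon> / \<epsilon>')"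
    using inverse_Hoelder by blast
  have "continuous_map X.B.mtopology Y.B.mtopology f"
  proof (rule continuous_map_Hoelder[OF X.Metric_space_boundary Y.Metric_space_boundary])
    show "visual_dist \<epsilon>' (f x) (f y) \<le> B * visual_dist \<epsilon> x y powr (L\<^sub>1 * \<epsilon>' / \<epsilon>)"
      if "x \<in> X.bd" "y \<in> X.bd" for x y by (rule B[OF that])
  qed (use extension(1) L1_pos X.eps_pos Y.eps_pos in auto)
  moreover have "continuous_map Y.B.mtopology X.B.mtopology g"
  proof (rule continuous_map_Hoelder[OF Y.Metric_space_boundary X.Metric_space_boundary])
    show "visual_dist \<epsilon> (g x) (g y) \<le> B' * visual_dist \<epsilon>' x y powr (1 / L\<^sub>2 * \<epsilon> / \<epsilon>')"
      if "x \<in> Y.bd" "y \<in> Y.bd" for x y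
      using B'[OF fg(2) fg(2), OF that] fg(1) that by simp
  qed (use fg L2_pos X.eps_pos Y.eps_pos in auto)
  ultimately have "homeomorphic_maps X.B.mtopology Y.B.mtopology f g"
    unfolding homeomorphic_maps_def using gf fg by simp
  then show ?thesis by (rule homeomorphic_maps_imp_map)
qed

theorem extension_quasisymmetric:
  "\<exists>A>0. quasisymmetric_map
     (\<lambda>t. if t \<le> 1 then A * t powr (L\<^sub>1 * \<epsilon>' / \<epsilon>) else A * t powr (L\<^sub>2 * \<epsilon>' / \<epsilon>))
     X.bd (visual_dist \<epsilon>) Y.bd (visual_dist \<epsilon>') f"
proof -
  obtain C where C: "\<And>\<zeta> \<xi> \<tau>. \<zeta> \<in> X.bd \<Longrightarrow> \<xi> \<in> X.bd \<Longrightarrow> \<tau> \<in> X.bd \<Longrightarrow> \<zeta> \<noteq> \<xi> \<Longrightarrow> \<zeta> \<noteq> \<tau> \<Longrightarrow>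
      real (Y.branch_level (f \<zeta>) (f \<tau>)) - real (Y.branch_level (f \<zeta>) (f \<xi>)) \<le>
      (if X.branch_level \<zeta> \<tau> \<le> X.branch_level \<zeta> \<xi> then L\<^sub>1 else L\<^sub>2) *
        (real (X.branch_level \<zeta> \<tau>) - real (X.branch_level \<zeta> \<xi>)) + C"
    by (rule branch_level_control) blast
  define A where "A = exp (\<epsilon>' * C)"
  define \<eta> where
    "\<eta> t = (if t \<le> 1 then A * t powr (L\<^sub>1 * \<epsilon>' / \<epsilon>) else A * t powr (L\<^sub>2 * \<epsilon>' / \<epsilon>))" for t
  have "visual_dist \<epsilon>' (f \<zeta>) (f \<xi>) / visual_dist \<epsilon>' (f \<zeta>) (f \<tau>)
      \<le> \<eta> (visual_dist \<epsilon> \<zeta> \<xi> / visual_dist \<epsilon> \<zeta> \<tau>)"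
    if pts: "\<zeta> \<in> X.bd" "\<xi> \<in> X.bd" "\<tau> \<in> X.bd" "\<zeta> \<noteq> \<tau>" for \<zeta> \<xi> \<tau>
  proof (cases "\<zeta> = \<xi>")
    case True
    then show ?thesis by (simp add: visual_dist_def \<eta>_def)
  next
    case False
    define a where "a = real (X.branch_level \<zeta> \<xi>)"
    define b where "b = real (X.branch_level \<zeta> \<tau>)"
    define a' where "a' = real (Y.branch_level (f \<zeta>) (f \<xi>))"
    define b' where "b' = real (Y.branch_level (f \<zeta>) (f \<tau>))"
    define L where "L = (if b \<le> a then L\<^sub>1 else L\<^sub>2)"
    have X: "visual_dist \<epsilon> \<zeta> \<xi> / visual_dist \<epsilon> \<zeta> \<tau> = exp (\<epsilon> * (b - a))"
      unfolding X.visual_dist_branch_level[OF False] X.visual_dist_branch_level[OF pts(4)]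
      using X.eps_pos by (simp add: a_def b_def exp_diff exp_minus field_simps)
    have Y: "visual_dist \<epsilon>' (f \<zeta>) (f \<xi>) / visual_dist \<epsilon>' (f \<zeta>) (f \<tau>) = exp (\<epsilon>' * (b' - a'))"
      unfolding Y.visual_dist_branch_level[OF extension_inj[OF pts(1,2) False]]
        Y.visual_dist_branch_level[OF extension_inj[OF pts(1,3,4)]]
      using Y.eps_pos by (simp add: a'_def b'_def exp_diff exp_minus field_simps)
    have "b' - a' \<le> L * (b - a) + C"
      using C[OF pts(1-3) False pts(4)] by (simp add: a_def b_def a'_def b'_def L_def)
    then have "\<epsilon>' * (b' - a') \<le> \<epsilon>' * (L * (b - a) + C)"
      using Y.eps_pos by (intro mult_left_mono) simp_all
    then have "exp (\<epsilon>' * (b' - a')) \<le> A * exp (\<epsilon>' * L * (b - a))"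
      unfolding A_def exp_add[symmetric] by (simp add: algebra_simps)
    also have "\<dots> = A * exp (\<epsilon> * (b - a)) powr (L * \<epsilon>' / \<epsilon>)"
      using X.eps_pos by (simp add: exp_powr_real mult_ac)
    also have "\<dots> = \<eta> (exp (\<epsilon> * (b - a)))"
    proof -
      have "exp (\<epsilon> * (b - a)) \<le> 1 \<longleftrightarrow> b \<le> a"
        using X.eps_pos by (simp add: mult_le_0_iff)
      then show ?thesis by (simp add: \<eta>_def L_def)
    qed
    finally show ?thesis unfolding X Y .
  qed
  moreover have "homeomorphic_map (top_of_set {0..}) (top_of_set {0..}) \<eta>"
    unfolding \<eta>_def[abs_def] using X.eps_pos Y.eps_pos L1_pos L2_pos
    by (intro homeomorphic_map_two_powers) (simp_all add: A_def)
  ultimately have "quasisymmetric_map \<eta> X.bd (visual_dist \<epsilon>) Y.bd (visual_dist \<epsilon>') f"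
    unfolding quasisymmetric_map_def using extension_homeomorphic by blast
  moreover have "A > 0" by (simp add: A_def)
  ultimately show ?thesis unfolding \<eta>_def[abs_def] by blast
qed

end

theorem theorem9p9:
  fixes V\<^sub>X :: "'a set" and E\<^sub>X :: "'a rel" and r\<^sub>X :: 'a
    and V\<^sub>Y :: "'b set" and E\<^sub>Y :: "'b rel" and r\<^sub>Y :: 'b
    and \<epsilon>\<^sub>X \<epsilon>\<^sub>Y L\<^sub>1 L\<^sub>2 \<Lambda> :: real
    and F :: "'a \<Rightarrow> 'b"
  assumes "rooted_tree V\<^sub>X E\<^sub>X r\<^sub>X" and "rooted_tree V\<^sub>Y E\<^sub>Y r\<^sub>Y"
    and "\<And>x. x \<in> V\<^sub>X \<Longrightarrow> tree_children E\<^sub>X r\<^sub>X x \<noteq> {}"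
    and "\<And>y. y \<in> V\<^sub>Y \<Longrightarrow> tree_children E\<^sub>Y r\<^sub>Y y \<noteq> {}"
    and "\<epsilon>\<^sub>X > 0" and "\<epsilon>\<^sub>Y > 0"
    and "L\<^sub>1 > 0" and "L\<^sub>2 > 0" and "\<Lambda> \<ge> 0"
    and "rough_quasiisometry V\<^sub>X E\<^sub>X V\<^sub>Y E\<^sub>Y (max (1 / L\<^sub>1) L\<^sub>2) \<Lambda> F"
    and "\<And>x\<^sub>1 x\<^sub>2. x\<^sub>1 \<in> V\<^sub>X \<Longrightarrow> x\<^sub>2 \<in> V\<^sub>X \<Longrightarrow>
           L\<^sub>1 * real (graph_dist E\<^sub>X x\<^sub>1 x\<^sub>2) - \<Lambda> \<le> real (graph_dist E\<^sub>Y (F x\<^sub>1) (F x\<^sub>2)) \<and>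
           real (graph_dist E\<^sub>Y (F x\<^sub>1) (F x\<^sub>2)) \<le> L\<^sub>2 * real (graph_dist E\<^sub>X x\<^sub>1 x\<^sub>2) + \<Lambda>"
  shows "\<exists>A > 0. quasisymmetric_map
           (\<lambda>t. if t \<le> 1 then A * t powr (L\<^sub>1 * \<epsilon>\<^sub>Y / \<epsilon>\<^sub>X) else A * t powr (L\<^sub>2 * \<epsilon>\<^sub>Y / \<epsilon>\<^sub>X))
           (tree_boundary V\<^sub>X E\<^sub>X r\<^sub>X) (visual_dist \<epsilon>\<^sub>X)
           (tree_boundary V\<^sub>Y E\<^sub>Y r\<^sub>Y) (visual_dist \<epsilon>\<^sub>Y)
           (boundary_extension V\<^sub>Y E\<^sub>Y r\<^sub>Y \<epsilon>\<^sub>Y F)"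
proof -
  define K where "K = max (1 / L\<^sub>1) L\<^sub>2 + \<Lambda>"
  have coarse: "F \<in> V\<^sub>X \<rightarrow> V\<^sub>Y"
    "\<And>y. y \<in> V\<^sub>Y \<Longrightarrow> \<exists>x\<in>V\<^sub>X. real (graph_dist E\<^sub>Y (F x) y) \<le> K"
    using assms(10) by (auto simp: rough_quasiisometry_def K_def)
  interpret X: rooted_tree V\<^sub>X E\<^sub>X r\<^sub>X by (rule assms(1))
  interpret Y: rooted_tree V\<^sub>Y E\<^sub>Y r\<^sub>Y by (rule assms(2))
  interpret tree_rough_quasiisometry V\<^sub>X E\<^sub>X r\<^sub>X \<epsilon>\<^sub>X V\<^sub>Y E\<^sub>Y r\<^sub>Y \<epsilon>\<^sub>Y F L\<^sub>1 L\<^sub>2 \<Lambda> K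
    by unfold_locales (use assms(5-9,11) coarse in auto)
  show ?thesis by (rule extension_quasisymmetric)
qed

end
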